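(* Let $V$ be a $p$-dimensional real inner product space and $\mathbf A=(A_1,\dots,A_q)\in\mathrm{End}(V)^q$. For $r$ even, $$T_r=\sum_{\substack{u\in2\mathbb N(q)\\|u|=r}}\binom{r/2}{u/2}\binom{r}{u}^{-1}T_u,\qquad S_r=\sum_{\substack{u\in2\mathbb N(q)\\|u|=r}}\binom{r/2}{u/2}\binom{r}{u}^{-1}\sigma_u,$$ and, for $r\ge2$ even and every $\alpha\in\{1,\dots,q\}$, $$T^\alpha_{r-1}=\sum_{\substack{u\in2\mathbb N(q)\\|u|=r}}\binom{r/2}{u/2}\binom{r}{u}^{-1}T_{\alpha_\flat(u)},$$ where $\frac u2=(\frac{u_1}2,\dots,\frac{u_q}2)$.
   Context: $\mathbb N=\{0,1,2,\dots\}$, $\mathbb N(q)$ is the set of multi-indices $u=(u_1,\dots,u_q)$ with $u_\alpha\in\mathbb N$, $|u|=\sum_\alpha u_\alpha$; $2\mathbb N(q)$ is the set of $u\in\mathbb N(q)$ with all entries even. $u!=u_1!\cdots u_q!$ and $\binom{r}{u}=\frac{r!}{u!}$ when $|u|=r$. $\alpha_\flat(u)$ is $u$ with $u_\alpha$ decreased by $1$. $\sigma_u=\sigma_u(\mathbf A)$ is defined by $\det(1_V+t_1A_1+\dots+t_qA_q)=\sum_{|u|\le p}\sigma_u t_1^{u_1}\cdots t_q^{u_q}$, $\sigma_u=0$ if $|u|>p$ or $u$ has a negative entry. $(T_u)_{u\in\mathbb N(q)}$ denotes the generalized Newton transformation of $\mathbf A$: the unique family of endomorphisms of $V$ such that for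 every $u\in\mathbb N(q)$ and every smooth curve $\mathbf A(\tau)$ in $\mathrm{End}(V)^q$ with $\mathbf A(0)=\mathbf A$, $\frac{d}{d\tau}|_{\tau=0}\sigma_u(\mathbf A(\tau))=\sum_\alpha\mathrm{tr}(A_\alpha'(0)T_{\alpha_\flat(u)})$, with $T_w:=0$ if $w$ has a negative entry. Fix an orthonormal basis of $V$; $(A)_{ij}$ denotes matrix entries, and $\delta^{i_1\dots i_r}_{j_1\dots j_r}$ is the generalized Kronecker symbol: $+1$ (resp. $-1$) if the $i$'s are distinct and the $j$'s are an even (resp. odd) permutation of the $i$'s, and $0$ otherwise. All Latin indices run over $1,\dots,p$ and Greek ones over $1,\dots,q$. For $r$ even put $$S_r=\frac1{r!}\sum_{\substack{i_1,\dots,i_r\\ j_1,\dots,j_r}}\delta^{i_1\dots i_r}_{j_1\dots j_r}\sum_{\alpha_1,\dots,\alpha_{r/2}}(A_{\alpha_1})_{i_1j_1}(A_{\alpha_1})_{i_2j_2}\cdots(A_{\alpha_{r/2}})_{i_{r-1}j_{r-1}}(A_{\alpha_{r/2}})_{i_rj_r},$$ $$(T_r)_{ij}=\frac1{r!}\sum_{\substack{i_1,\dots,i_r\\ j_1,\dots,j_r}}\delta^{i_1\dots i_r\,j}_{j_1\dots j_r\,i}\sum_{\alpha_1,\dots,\alpha_{r/2}}(A_{\alpha_1})_{i_1j_1}(A_{\alpha_1})_{i_2j_2}\cdots(A_{\alpha_{r/2}})_{i_{r-1}j_{r-1}}(A_{\alpha_{r/2}})_{i_rj_r},$$ $$(T^\alpha_{r+1})_{ij}=\frac1{(r+1)!}\sum_{\substack{i_1,\dots,i_{r+1}\\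 j_1,\dots,j_{r+1}}}\delta^{i_1\dots i_{r+1}\,j}_{j_1\dots j_{r+1}\,i}(A_\alpha)_{i_{r+1}j_{r+1}}\sum_{\alpha_1,\dots,\alpha_{r/2}}(A_{\alpha_1})_{i_1j_1}(A_{\alpha_1})_{i_2j_2}\cdots(A_{\alpha_{r/2}})_{i_{r-1}j_{r-1}}(A_{\alpha_{r/2}})_{i_rj_r}.$$ ($S_0=1$, $T_0=1_V$. An integer subscript refers to these operators, a multi-index subscript to the generalized Newton transformation.) *)

theory Defs
  imports "HOL-Analysis.Analysis" "HOL-Combinatorics.Permutations"
begin

section \<open>Endomorphisms of a finite-dimensional inner product space\<close>

text \<open>
  \<open>V\<close> is a type \<open>'v\<close> of class \<open>real_inner\<close> carrying an orthonormal basis indexed by a finite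
  type \<open>'p\<close>; thus \<open>dim V = CARD('p)\<close>.  As \<open>V\<close> is then finite-dimensional, \<open>End(V)\<close> is the type
  \<open>'v \<Rightarrow>\<^sub>L 'v\<close> of bounded linear maps, and \<open>End(V)\<^sup>q\<close> is \<open>('v \<Rightarrow>\<^sub>L 'v)^'q\<close> with \<open>q = CARD('q)\<close>.
\<close>

definition orthonormal_basis :: "('p::finite \<Rightarrow> 'v::real_inner) \<Rightarrow> bool" where
  "orthonormal_basis e \<longleftrightarrow>
     (\<forall>i j. e i \<bullet> e j = (if i = j then 1 else 0)) \<and> span (range e) = UNIV"

definition entry :: "('p \<Rightarrow> 'v::real_inner) \<Rightarrow> ('v \<Rightarrow>\<^sub>L 'v) \<Rightarrow> 'p \<Rightarrow> 'p \<Rightarrow> real" where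
  "entry e A i j = e i \<bullet> blinfun_apply A (e j)"

definition endo_of_entries ::
  "('p::finite \<Rightarrow> 'v::real_inner) \<Rightarrow> ('p \<Rightarrow> 'p \<Rightarrow> real) \<Rightarrow> ('v \<Rightarrow>\<^sub>L 'v)" where
  "endo_of_entries e M =
     Blinfun (\<lambda>x. \<Sum>i\<in>UNIV. (\<Sum>j\<in>UNIV. M i j * (e j \<bullet> x)) *\<^sub>R e i)"

text \<open>
  The determinant and trace of an endomorphism are taken in the fixed basis \<open>e\<close>; they do not depend
  on it, hence neither do \<open>\<sigma>\<^sub>u\<close> and the generalized Newton transformation below.
\<close>
definition endo_det :: "('p::finite \<Rightarrow> 'v::real_inner) \<Rightarrow> ('v \<Rightarrow>\<^sub>L 'v) \<Rightarrow> real" where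
  "endo_det e A = det (\<chi> i j. entry e A i j)"

definition endo_trace :: "('p::finite \<Rightarrow> 'v::real_inner) \<Rightarrow> ('v \<Rightarrow>\<^sub>L 'v) \<Rightarrow> real" where
  "endo_trace e A = trace (\<chi> i j. entry e A i j)"


section \<open>Multi-indices\<close>

definition mi_size :: "('q::finite \<Rightarrow> nat) \<Rightarrow> nat" where
  "mi_size u = (\<Sum>\<alpha>\<in>UNIV. u \<alpha>)"

definition mi_even :: "('q \<Rightarrow> nat) \<Rightarrow> bool" where
  "mi_even u \<longleftrightarrow> (\<forall>\<alpha>. even (u \<alpha>))"

definition multinom :: "nat \<Rightarrow> ('q::finite \<Rightarrow> nat) \<Rightarrow> real" where
  "multinom r u = fact r / (\<Prod>\<alpha>\<in>UNIV. fact (u \<alpha>))"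

definition mi_half :: "('q \<Rightarrow> nat) \<Rightarrow> ('q \<Rightarrow> nat)" where
  "mi_half u = (\<lambda>\<alpha>. u \<alpha> div 2)"

text \<open>
  \<open>at_flat T \<alpha> u\<close> is \<open>T\<close> at the multi-index \<open>\<alpha>\<^sub>\<flat>(u)\<close>.  Since multi-indices are natural-valued, the
  convention \<open>T\<^sub>w = 0\<close> for \<open>w\<close> with a negative entry is applied here: \<open>\<alpha>\<^sub>\<flat>(u)\<close> has a negative entry
  exactly when \<open>u \<alpha> = 0\<close>.
\<close>
definition at_flat :: "(('q \<Rightarrow> nat) \<Rightarrow> 'a::zero) \<Rightarrow> 'q \<Rightarrow> ('q \<Rightarrow> nat) \<Rightarrow> 'a" where
  "at_flat T \<alpha> u = (if u \<alpha> = 0 then 0 else T (u(\<alpha> := u \<alpha> - 1)))"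


section \<open>The functions \<open>\<sigma>\<^sub>u\<close> and the generalized Newton transformation\<close>

text \<open>The coefficients of the polynomial function \<open>det(1 + t\<^sub>1 A\<^sub>1 + \<dots> + t\<^sub>q A\<^sub>q)\<close> on \<open>\<real>\<^sup>q\<close>.\<close>
definition sigma_coeff ::
  "('p::finite \<Rightarrow> 'v::real_inner) \<Rightarrow> ('v \<Rightarrow>\<^sub>L 'v)^'q \<Rightarrow> ('q::finite \<Rightarrow> nat) \<Rightarrow> real" where
  "sigma_coeff e A = (THE s.
     (\<forall>u. mi_size u > CARD('p) \<longrightarrow> s u = 0) \<and>
     (\<forall>t :: 'q \<Rightarrow> real.
        endo_det e (id_blinfun + (\<Sum>\<alpha>\<in>UNIV. t \<alpha> *\<^sub>R A $ \<alpha>)) =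
        (\<Sum>u | mi_size u \<le> CARD('p). s u * (\<Prod>\<alpha>\<in>UNIV. t \<alpha> ^ u \<alpha>))))"

text \<open>\<open>c\<close> is infinitely differentiable on the open set \<open>S\<close>; \<open>D k\<close> is its \<open>k\<close>-th derivative.\<close>
definition smooth_curve_on :: "real set \<Rightarrow> (real \<Rightarrow> 'a::real_normed_vector) \<Rightarrow> bool" where
  "smooth_curve_on S c \<longleftrightarrow> (\<exists>D :: nat \<Rightarrow> real \<Rightarrow> 'a. D 0 = c \<and>
     (\<forall>k. \<forall>t\<in>S. (D k has_vector_derivative D (Suc k) t) (at t)))"

definition is_gen_newton ::
  "('p::finite \<Rightarrow> 'v::real_inner) \<Rightarrow> ('v \<Rightarrow>\<^sub>L 'v)^'q \<Rightarrow>
   (('q::finite \<Rightarrow> nat) \<Rightarrow> ('v \<Rightarrow>\<^sub>L 'v)) \<Rightarrow> bool" where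
  "is_gen_newton e A T \<longleftrightarrow>
     (\<forall>u. \<forall>\<epsilon>>0. \<forall>c :: real \<Rightarrow> ('v \<Rightarrow>\<^sub>L 'v)^'q.
        smooth_curve_on {-\<epsilon><..<\<epsilon>} c \<and> c 0 = A \<longrightarrow>
        ((\<lambda>\<tau>. sigma_coeff e (c \<tau>) u) has_real_derivative
           (\<Sum>\<alpha>\<in>UNIV. endo_trace e (vector_derivative c (at 0) $ \<alpha> o\<^sub>L at_flat T \<alpha> u))) (at 0))"

definition gen_newton ::
  "('p::finite \<Rightarrow> 'v::real_inner) \<Rightarrow> ('v \<Rightarrow>\<^sub>L 'v)^'q \<Rightarrow>
   ('q::finite \<Rightarrow> nat) \<Rightarrow> ('v \<Rightarrow>\<^sub>L 'v)" where
  "gen_newton e A = (THE T. is_gen_newton e A T)"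


section \<open>The operators \<open>S\<^sub>r\<close>, \<open>T\<^sub>r\<close> and \<open>T\<^sup>\<alpha>\<^sub>s\<close>\<close>

text \<open>Generalized Kronecker symbol with upper indices \<open>is\<close> and lower indices \<open>js\<close>.\<close>
definition gen_kronecker :: "'p list \<Rightarrow> 'p list \<Rightarrow> real" where
  "gen_kronecker is js =
     (if distinct is \<and> (\<exists>\<pi>. \<pi> permutes {..<length is} \<and> evenperm \<pi> \<and> js = permute_list \<pi> is)
        then 1
      else if distinct is \<and> (\<exists>\<pi>. \<pi> permutes {..<length is} \<and> \<not> evenperm \<pi> \<and> js = permute_list \<pi> is)
        then -1
      else 0)"

text \<open>
  The inner sum over \<open>\<alpha>\<^sub>1, \<dots>, \<alpha>\<^sub>m\<close> common to the three families.  Lists are indexed from 0, so the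
  factor \<open>k < m\<close> carries the Latin positions \<open>2k\<close> and \<open>2k + 1\<close>; entries of \<open>is\<close> and \<open>js\<close> beyond the
  first \<open>2m\<close> are not used.
\<close>
definition pair_sum ::
  "('p \<Rightarrow> 'v::real_inner) \<Rightarrow> ('v \<Rightarrow>\<^sub>L 'v)^'q \<Rightarrow> nat \<Rightarrow> 'p list \<Rightarrow> 'p list \<Rightarrow> real" where
  "pair_sum e A m is js =
     (\<Sum>as | length (as :: 'q::finite list) = m.
        \<Prod>k<m. entry e (A $ (as ! k)) (is ! (2*k)) (js ! (2*k)) *
               entry e (A $ (as ! k)) (is ! (2*k + 1)) (js ! (2*k + 1)))"

definition S_even :: "('p::finite \<Rightarrow> 'v::real_inner) \<Rightarrow> ('v \<Rightarrow>\<^sub>L 'v)^'q::finite \<Rightarrow> nat \<Rightarrow> real" where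
  "S_even e A r = 1 / fact r *
     (\<Sum>is | length is = r. \<Sum>js | length js = r.
        gen_kronecker is js * pair_sum e A (r div 2) is js)"

definition T_even ::
  "('p::finite \<Rightarrow> 'v::real_inner) \<Rightarrow> ('v \<Rightarrow>\<^sub>L 'v)^'q::finite \<Rightarrow> nat \<Rightarrow> ('v \<Rightarrow>\<^sub>L 'v)" where
  "T_even e A r = endo_of_entries e (\<lambda>i j. 1 / fact r *
     (\<Sum>is | length is = r. \<Sum>js | length js = r.
        gen_kronecker (is @ [j]) (js @ [i]) * pair_sum e A (r div 2) is js))"

text \<open>\<open>T_odd e A \<alpha> s\<close> is meant for odd \<open>s = r + 1\<close>; the last pair of indices is attached to \<open>A\<^sub>\<alpha>\<close>.\<close>
definition T_odd ::
  "('p::finite \<Rightarrow> 'v::real_inner) \<Rightarrow> ('v \<Rightarrow>\<^sub>L 'v)^'q::finite \<Rightarrow> 'q \<Rightarrow> nat \<Rightarrow> ('v \<Rightarrow>\<^sub>L 'v)" where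
  "T_odd e A \<alpha> s = endo_of_entries e (\<lambda>i j. 1 / fact s *
     (\<Sum>is | length is = s. \<Sum>js | length js = s.
        gen_kronecker (is @ [j]) (js @ [i]) *
        entry e (A $ \<alpha>) (is ! (s - 1)) (js ! (s - 1)) * pair_sum e A ((s - 1) div 2) is js))"

end

theory Submission
  imports Defs "HOL-Combinatorics.Multiset_Permutations"
begin

text \<open>
  Choosing a letter \<open>\<alpha>\<close> for each of \<open>r\<close> slots gives a word \<open>w\<close>.  The Kronecker sum with the matrix
  \<open>A\<^bsub>w\<^sub>k\<^esub>\<close> in slot \<open>k\<close> is a mixed minor sum \<open>D(w)\<close>, multilinear and symmetric in its slots; so
  \<open>D(w)\<close> depends on \<open>w\<close> only through the multi-index \<open>u\<close> that counts its letters.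

  Expanding \<open>det(1 + M)\<close> into principal minors, with \<open>M = t\<^sub>1 A\<^sub>1 + \<dots> + t\<^sub>q A\<^sub>q\<close>, and then by
  multilinearity into words shows that \<open>\<sigma>\<^sub>u\<close> is \<open>1 / |u|!\<close> times the sum of \<open>D(w)\<close> over the words with
  multi-index \<open>u\<close> (lemmas \<open>det_one_plus\<close>, \<open>det_expansion\<close>, \<open>sigma_coeff_eq\<close>).  Differentiating this
  formula moves one letter \<open>\<alpha>\<close> out of the word and leaves a word with multi-index \<open>\<alpha>\<^sub>\<flat>(u)\<close> and a
  cofactor paired with \<open>A'\<^sub>\<alpha>\<close>.  Hence \<open>T\<^sub>u\<close> is \<open>1 / |u|!\<close> times the transposed sum of the cofactors over
  the words with multi-index \<open>u\<close> (lemmas \<open>sigma_formula_has_derivative\<close>, \<open>gen_newton_eq\<close>);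
  the defining property determines it, as the trace form is nondegenerate.

  On the other side, \<open>S\<^sub>r\<close> and \<open>T\<^sub>r\<close> are sums of the same minors and cofactors over the words
  \<open>\<alpha>\<^sub>1\<alpha>\<^sub>1\<alpha>\<^sub>2\<alpha>\<^sub>2\<dots>\<close> in which every letter is doubled.  Such a word has an even multi-index \<open>u\<close>; there are as
  many of them as words with multi-index \<open>u/2\<close>, and each contributes the average over all words with
  multi-index \<open>u\<close>.  The quotient of the two numbers of words is the quotient of multinomial
  coefficients in the theorem (lemma \<open>sum_doubled\<close>).  For \<open>T\<^sup>\<alpha>\<close> the doubled word is followed by the
  single letter \<open>\<alpha>\<close>, and an identity between multinomial coefficients in neighbouring degrees gives the
  same quotient (lemma \<open>sum_doubled_snoc\<close>).
\<close>

section \<open>The generalized Kronecker symbol as a sign\<close>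

lemma finite_lists_of_length [simp]: "finite {xs :: 'a::finite list. length xs = n}"
  using finite_lists_length_eq[of "UNIV :: 'a set" n] by simp

text \<open>
  As the entries of \<open>is\<close> are distinct, the list \<open>permute_list \<rho> is\<close> determines \<open>\<rho>\<close>; so only one of
  the two existential clauses in the definition of the symbol can hold.
\<close>
lemma gen_kronecker_permute_list:
  assumes "distinct is" and \<rho>: "\<rho> permutes {..<length is}"
  shows "gen_kronecker is (permute_list \<rho> is) = of_int (sign \<rho>)"
proof -
  have uniq: "\<pi> = \<rho>" if \<pi>: "\<pi> permutes {..<length is}" and eq: "permute_list \<rho> is = permute_list \<pi> is" for \<pi>
  proof
    fix k
    show "\<pi> k = \<rho> k"
    proof (cases "k < length is")
      case True
      then have "is ! (\<pi> k) = is ! (\<rho> k)"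
        using permute_list_nth[OF \<pi> True] permute_list_nth[OF \<rho> True] eq by simp
      moreover have "\<pi> k < length is" "\<rho> k < length is"
        using True permutes_in_image[OF \<pi>, of k] permutes_in_image[OF \<rho>, of k] by auto
      ultimately show ?thesis
        using \<open>distinct is\<close> by (simp add: nth_eq_iff_index_eq)
    next
      case False
      then show ?thesis
        using permutes_not_in[OF \<pi>] permutes_not_in[OF \<rho>] by simp
    qed
  qed
  show ?thesis
    unfolding gen_kronecker_def sign_def using assms uniq by auto
qed

text \<open>
  A permutation of the positions of a list with distinct entries, transported along the numbering of
  the entries, is a permutation of the entries with the same sign.  This removes the positions from
  the computations below: a pair \<open>is\<close>, \<open>js\<close> with nonzero symbol is a list \<open>is\<close> with distinct entries
  together with a permutation of \<open>set is\<close>.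
\<close>
lemma map_permutation_nth:
  assumes "distinct is" and \<rho>: "\<rho> permutes {..<length is}"
  defines "\<sigma> \<equiv> map_permutation {..<length is} ((!) is) \<rho>"
  shows "\<sigma> permutes set is" and "map \<sigma> is = permute_list \<rho> is" and "sign \<sigma> = sign \<rho>"
proof -
  have bij: "bij_betw ((!) is) {..<length is} (set is)"
    using bij_betw_nth[OF \<open>distinct is\<close>] by simp
  then have inj: "inj_on ((!) is) {..<length is}"
    by (rule bij_betw_imp_inj_on)
  show "\<sigma> permutes set is"
    unfolding \<sigma>_def using bij \<rho> by (rule map_permutation_permutes)
  show "map \<sigma> is = permute_list \<rho> is"
    by (rule nth_equalityI)
       (use inj \<rho> in \<open>auto simp: \<sigma>_def map_permutation_apply permute_list_nth\<close>)
  show "sign \<sigma> = sign \<rho>"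
    unfolding \<sigma>_def using inj \<rho> by (rule sign_map_permutation) simp
qed

lemma gen_kronecker_map:
  assumes "distinct is" and \<sigma>: "\<sigma> permutes set is"
  shows "gen_kronecker is (map \<sigma> is) = of_int (sign \<sigma>)"
proof -
  have "mset (map \<sigma> is) = mset is"
    using assms permutes_imp_bij[OF \<sigma>]
    by (metis bij_betw_imp_inj_on bij_betw_imp_surj_on distinct_map set_eq_iff_mset_eq_distinct set_map)
  then obtain \<rho> where \<rho>: "\<rho> permutes {..<length is}" and eq: "permute_list \<rho> is = map \<sigma> is"
    by (rule mset_eq_permutation)
  let ?\<tau> = "map_permutation {..<length is} ((!) is) \<rho>"
  have "?\<tau> = \<sigma>"
  proof
    fix x
    show "?\<tau> x = \<sigma> x"
      using map_permutation_nth(2)[OF \<open>distinct is\<close> \<rho>] eq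
        permutes_not_in[OF map_permutation_nth(1)[OF \<open>distinct is\<close> \<rho>], of x]
        permutes_not_in[OF \<sigma>, of x]
      by (cases "x \<in> set is") auto
  qed
  then show ?thesis
    using gen_kronecker_permute_list[OF \<open>distinct is\<close> \<rho>] map_permutation_nth(3)[OF \<open>distinct is\<close> \<rho>] eq
    by simp
qed

lemma gen_kronecker_nonzeroE:
  assumes "gen_kronecker is js \<noteq> 0"
  obtains \<sigma> where "distinct is" "\<sigma> permutes set is" "js = map \<sigma> is"
proof -
  obtain \<rho> where "distinct is" "\<rho> permutes {..<length is}" "js = permute_list \<rho> is"
    using assms unfolding gen_kronecker_def by (auto split: if_splits)
  then show ?thesis
    using that map_permutation_nth by metis
qed

section \<open>Mixed principal minors\<close>

text \<open>
  For \<open>r\<close> copies of one matrix this is \<open>r!\<close> times the sum of its principal minors of size \<open>r\<close>; in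
  general it is the polarization of that homogeneous polynomial.
\<close>
definition mixed_minors :: "('p::finite \<Rightarrow> 'p \<Rightarrow> real) list \<Rightarrow> real" where
  "mixed_minors Ms = (\<Sum>is | length is = length Ms. \<Sum>js | length js = length Ms.
     gen_kronecker is js * (\<Prod>k<length Ms. (Ms ! k) (is ! k) (js ! k)))"

text \<open>
  The value of the sum over \<open>\<sigma>\<close> is a mixed minor on the rows and columns \<open>set is\<close>; the list \<open>is\<close>
  enters further only by telling which matrix supplies which row.
\<close>
lemma mixed_minors_eq_sum_permutes:
  "mixed_minors Ms = (\<Sum>is | length is = length Ms \<and> distinct is. \<Sum>\<sigma> | \<sigma> permutes set is.
     of_int (sign \<sigma>) * (\<Prod>k<length Ms. (Ms ! k) (is ! k) (\<sigma> (is ! k))))"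
proof -
  let ?g = "\<lambda>is js. gen_kronecker is js * (\<Prod>k<length Ms. (Ms ! k) (is ! k) (js ! k))"
  have inner: "(\<Sum>js | length js = length Ms. ?g is js) =
      (\<Sum>\<sigma> | \<sigma> permutes set is. of_int (sign \<sigma>) * (\<Prod>k<length Ms. (Ms ! k) (is ! k) (\<sigma> (is ! k))))"
    if len: "length is = length Ms" and dist: "distinct is" for "is"
  proof -
    have inj: "inj_on (\<lambda>\<sigma>. map \<sigma> is) {\<sigma>. \<sigma> permutes set is}"
    proof (rule inj_onI, rule ext)
      fix \<sigma> \<tau> x
      assume "\<sigma> \<in> {\<sigma>. \<sigma> permutes set is}" "\<tau> \<in> {\<sigma>. \<sigma> permutes set is}" "map \<sigma> is = map \<tau> is"
      then show "\<sigma> x = \<tau> x"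
        by (cases "x \<in> set is") (auto simp: permutes_not_in)
    qed
    have "(\<Sum>js | length js = length Ms. ?g is js) =
        (\<Sum>js\<in>(\<lambda>\<sigma>. map \<sigma> is) ` {\<sigma>. \<sigma> permutes set is}. ?g is js)"
    proof (rule sum.mono_neutral_right)
      show "\<forall>js\<in>{js. length js = length Ms} - (\<lambda>\<sigma>. map \<sigma> is) ` {\<sigma>. \<sigma> permutes set is}. ?g is js = 0"
        by (auto elim!: gen_kronecker_nonzeroE)
    qed (use len in auto)
    also have "\<dots> = (\<Sum>\<sigma> | \<sigma> permutes set is. ?g is (map \<sigma> is))"
      by (simp add: sum.reindex[OF inj])
    also have "\<dots> = (\<Sum>\<sigma> | \<sigma> permutes set is.
        of_int (sign \<sigma>) * (\<Prod>k<length Ms. (Ms ! k) (is ! k) (\<sigma> (is ! k))))"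
      by (rule sum.cong) (use len dist in \<open>auto simp: gen_kronecker_map\<close>)
    finally show ?thesis .
  qed
  have "mixed_minors Ms = (\<Sum>is | length is = length Ms \<and> distinct is. \<Sum>js | length js = length Ms. ?g is js)"
    unfolding mixed_minors_def by (rule sum.mono_neutral_right) (auto simp: gen_kronecker_def)
  also have "\<dots> = (\<Sum>is | length is = length Ms \<and> distinct is. \<Sum>\<sigma> | \<sigma> permutes set is.
     of_int (sign \<sigma>) * (\<Prod>k<length Ms. (Ms ! k) (is ! k) (\<sigma> (is ! k))))"
    by (rule sum.cong) (auto intro: inner)
  finally show ?thesis .
qed

text \<open>
  Permuting the matrices amounts to permuting the list of rows in the previous formula, and this
  leaves the set of rows, hence the range of \<open>\<sigma>\<close>, unchanged.
\<close>
lemma mixed_minors_symmetric: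
  assumes "mset Ms = mset Ns"
  shows "mixed_minors Ms = mixed_minors Ns"
proof -
  obtain \<pi> where \<pi>: "\<pi> permutes {..<length Ns}" and Ms: "permute_list \<pi> Ns = Ms"
    using assms by (rule mset_eq_permutation)
  have len: "length Ms = length Ns"
    using Ms by auto
  let ?P = "\<lambda>Ms is \<sigma>. \<Prod>k<length Ns. (Ms ! k) (is ! k) (\<sigma> (is ! k) :: 'a)"
  have "mixed_minors Ms = (\<Sum>is | length is = length Ns \<and> distinct is. \<Sum>\<sigma> | \<sigma> permutes set is.
      of_int (sign \<sigma>) * ?P Ms is \<sigma>)"
    by (simp add: mixed_minors_eq_sum_permutes len)
  also have "\<dots> = (\<Sum>is | length is = length Ns \<and> distinct is. \<Sum>\<sigma> | \<sigma> permutes set is.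
      of_int (sign \<sigma>) * ?P Ns is \<sigma>)"
  proof (rule sum.reindex_bij_witness[where i = "permute_list \<pi>" and j = "permute_list (inv \<pi>)"])
    fix "is" :: "'a list"
    assume is_mem: "is \<in> {is. length is = length Ns \<and> distinct is}"
    then have \<pi>': "\<pi> permutes {..<length is}" and inv: "inv \<pi> permutes {..<length is}"
      using \<pi> by (auto intro: permutes_inv)
    show "permute_list \<pi> (permute_list (inv \<pi>) is) = is"
      using permute_list_compose[OF \<pi>', of "inv \<pi>"] permutes_inv_o[OF \<pi>'] by simp
    show "permute_list (inv \<pi>) (permute_list \<pi> is) = is"
      using permute_list_compose[OF inv, of \<pi>] permutes_inv_o[OF \<pi>'] by simp
    show "permute_list \<pi> is \<in> {is. length is = length Ns \<and> distinct is}"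
      "permute_list (inv \<pi>) is \<in> {is. length is = length Ns \<and> distinct is}"
      using is_mem \<pi>' inv by auto
    have "?P Ns (permute_list (inv \<pi>) is) \<sigma> = ?P Ms is \<sigma>" for \<sigma>
    proof -
      have "?P Ns (permute_list (inv \<pi>) is) \<sigma> =
          (\<Prod>k<length Ns. (Ns ! \<pi> k) (permute_list (inv \<pi>) is ! \<pi> k) (\<sigma> (permute_list (inv \<pi>) is ! \<pi> k)))"
        by (rule prod.permute[OF \<pi>, unfolded o_def])
      also have "\<dots> = ?P Ms is \<sigma>"
      proof (rule prod.cong)
        fix k assume "k \<in> {..<length Ns}"
        then have "\<pi> k < length is"
          using permutes_in_image[OF \<pi>, of k] is_mem by auto
        then have "permute_list (inv \<pi>) is ! \<pi> k = is ! k"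
          using permute_list_nth[OF inv] permutes_inverses(2)[OF \<pi>] by simp
        moreover have "Ms ! k = Ns ! \<pi> k"
          using Ms permute_list_nth[OF \<pi>] \<open>k \<in> _\<close> by auto
        ultimately show "(Ns ! \<pi> k) (permute_list (inv \<pi>) is ! \<pi> k) (\<sigma> (permute_list (inv \<pi>) is ! \<pi> k)) =
            (Ms ! k) (is ! k) (\<sigma> (is ! k))"
          by simp
      qed simp
      finally show ?thesis .
    qed
    then show "(\<Sum>\<sigma> | \<sigma> permutes set (permute_list (inv \<pi>) is). of_int (sign \<sigma>) * ?P Ns (permute_list (inv \<pi>) is) \<sigma>) =
        (\<Sum>\<sigma> | \<sigma> permutes set is. of_int (sign \<sigma>) * ?P Ms is \<sigma>)"
      using set_permute_list[OF inv] by simp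
  qed
  also have "\<dots> = mixed_minors Ns"
    by (simp add: mixed_minors_eq_sum_permutes)
  finally show ?thesis .
qed

text \<open>
  There are no lists of distinct rows that are longer than the number of rows.
\<close>
lemma mixed_minors_eq_0:
  fixes Ms :: "('p::finite \<Rightarrow> 'p \<Rightarrow> real) list"
  assumes "CARD('p) < length Ms"
  shows "mixed_minors Ms = 0"
proof -
  have "length is \<le> CARD('p)" if "distinct is" for "is" :: "'p list"
    using distinct_card[OF that] card_mono[of UNIV "set is"] by simp
  then have "{is :: 'p list. length is = length Ms \<and> distinct is} = {}"
    using assms by (force simp: not_less[symmetric])
  then show ?thesis
    by (simp only: mixed_minors_eq_sum_permutes sum.empty)
qed

lemma sum_distinct_lists:
  fixes f :: "'p::finite set \<Rightarrow> real"
  shows "(\<Sum>is | length is = r \<and> distinct is. f (set is)) = fact r * (\<Sum>S | card S = r. f S)"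
proof -
  have "(\<Sum>is | length is = r \<and> distinct is. f (set is)) =
      (\<Sum>S | card S = r. \<Sum>is | is \<in> {is. length is = r \<and> distinct is} \<and> set is = S. f (set is))"
    by (rule sum.group[symmetric])
       (auto simp: distinct_card intro: finite_subset[OF _ finite_lists_of_length[of r]])
  also have "\<dots> = (\<Sum>S | card S = r. \<Sum>is\<in>permutations_of_set S. f S)"
    by (intro sum.cong) (auto simp: permutations_of_set_def distinct_card)
  also have "\<dots> = (\<Sum>S | card S = r. fact r * f S)"
    by (rule sum.cong) auto
  finally show ?thesis
    by (simp add: sum_distrib_left)
qed

text \<open>
  Expanding each factor of \<open>\<Prod>\<^sub>i (M\<^sub>i\<^sub>\<sigma>\<^sub>i + \<delta>\<^sub>i\<^sub>\<sigma>\<^sub>i)\<close> selects a set \<open>S\<close> of rows that take their entry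
  from \<open>M\<close>; the remaining factors vanish unless \<open>\<sigma>\<close> fixes the complement of \<open>S\<close>.  So the determinant
  is the sum of all principal minors of \<open>M\<close>, and a minor of size \<open>r\<close> occurs in the mixed minors once
  for each of the \<open>r!\<close> orderings of its rows.
\<close>
lemma det_one_plus:
  fixes M :: "'p::finite \<Rightarrow> 'p \<Rightarrow> real"
  shows "det (\<chi> i j. (if i = j then 1 else 0) + M i j) =
    (\<Sum>r\<le>CARD('p). mixed_minors (replicate r M) / fact r)"
proof -
  let ?m = "\<lambda>S. \<Sum>\<sigma> | \<sigma> permutes S. of_int (sign \<sigma>) * (\<Prod>i\<in>S. M i (\<sigma> i))"
  \<comment> \<open>the rows outside \<open>S\<close> contribute Kronecker deltas, which select the \<open>\<sigma>\<close> that move only \<open>S\<close>\<close>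
  have fixed: "(\<Prod>i\<in>UNIV - S. if i = \<sigma> i then 1 else 0 :: real) = (if \<sigma> permutes S then 1 else 0)"
    if "\<sigma> permutes UNIV" for \<sigma> and S :: "'p set"
  proof -
    have "\<sigma> permutes S \<longleftrightarrow> (\<forall>i\<in>UNIV - S. i = \<sigma> i)"
      using that by (auto simp: permutes_def)
    then show ?thesis
      by (auto simp: prod_zero_iff)
  qed
  have "det (\<chi> i j. (if i = j then 1 else 0) + M i j) =
      (\<Sum>\<sigma> | \<sigma> permutes UNIV. of_int (sign \<sigma>) * (\<Prod>i\<in>UNIV. M i (\<sigma> i) + (if i = \<sigma> i then 1 else 0)))"
    by (simp add: det_def add.commute)
  also have "\<dots> = (\<Sum>\<sigma> | \<sigma> permutes UNIV. \<Sum>S\<in>UNIV. 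
      if \<sigma> permutes S then of_int (sign \<sigma>) * (\<Prod>i\<in>S. M i (\<sigma> i)) else 0)"
    by (rule sum.cong) (auto simp: prod_add sum_distrib_left fixed intro!: sum.cong)
  also have "\<dots> = (\<Sum>S\<in>UNIV. \<Sum>\<sigma> | \<sigma> permutes UNIV.
      if \<sigma> permutes S then of_int (sign \<sigma>) * (\<Prod>i\<in>S. M i (\<sigma> i)) else 0)"
    by (rule sum.swap)
  also have "\<dots> = (\<Sum>S\<in>UNIV. ?m S)"
    by (intro sum.cong refl sum.mono_neutral_cong_right) (auto intro: permutes_subset)
  also have "\<dots> = (\<Sum>r\<le>CARD('p). \<Sum>S | S \<in> UNIV \<and> card S = r. ?m S)"
    by (rule sum.group[symmetric]) (auto intro: card_mono)
  also have "\<dots> = (\<Sum>r\<le>CARD('p). mixed_minors (replicate r M) / fact r)"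
  proof (rule sum.cong)
    fix r
    have "mixed_minors (replicate r M) = (\<Sum>is | length is = r \<and> distinct is. ?m (set is))"
      unfolding mixed_minors_eq_sum_permutes
    proof (intro sum.cong)
      fix "is" :: "'p list" and \<sigma>
      assume "is \<in> {is. length is = r \<and> distinct is}"
      then have "(\<Prod>k<r. M (is ! k) (\<sigma> (is ! k))) = (\<Prod>i\<in>set is. M i (\<sigma> i))"
        using bij_betw_nth[of "is"] by (intro prod.reindex_bij_betw) auto
      then show "of_int (sign \<sigma>) * (\<Prod>k<length (replicate r M). (replicate r M ! k) (is ! k) (\<sigma> (is ! k))) =
          of_int (sign \<sigma>) * (\<Prod>i\<in>set is. M i (\<sigma> i))"
        by simp
    qed auto
    then show "(\<Sum>S | S \<in> UNIV \<and> card S = r. ?m S) = mixed_minors (replicate r M) / fact r"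
      using sum_distinct_lists[where r = r and f = ?m] by simp
  qed simp
  finally show ?thesis .
qed

section \<open>Words and their multi-indices\<close>

lemma sum_lists_snoc:
  fixes F :: "'a::finite list \<Rightarrow> 'b::comm_monoid_add"
  shows "(\<Sum>w | length w = Suc n. F w) = (\<Sum>w | length w = n. \<Sum>a\<in>UNIV. F (w @ [a]))"
proof -
  have "(\<Sum>w | length w = Suc n. F w) = (\<Sum>(w, a)\<in>{w. length w = n} \<times> UNIV. F (w @ [a]))"
    by (rule sum.reindex_bij_witness[where i = "\<lambda>(w, a). w @ [a]" and j = "\<lambda>w. (butlast w, last w)"])
       (auto simp: length_Suc_conv_rev)
  then show ?thesis
    by (simp add: sum.cartesian_product)
qed

lemma prod_sum_lists:
  fixes f :: "nat \<Rightarrow> 'a::finite \<Rightarrow> 'b::comm_semiring_1"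
  shows "(\<Prod>k<r. \<Sum>a\<in>UNIV. f k a) = (\<Sum>w | length w = r. \<Prod>k<r. f k (w ! k))"
proof (induction r)
  case 0
  then show ?case by simp
next
  case (Suc r)
  have "(\<Sum>w | length w = Suc r. \<Prod>k<Suc r. f k (w ! k)) =
      (\<Sum>w | length w = r. \<Sum>a\<in>UNIV. (\<Prod>k<r. f k (w ! k)) * f r a)"
    unfolding sum_lists_snoc by (intro sum.cong) (auto simp: nth_append)
  then show ?case
    using Suc by (simp add: sum_product)
qed

text \<open>
  Multilinearity: from each slot one letter is chosen, and the choices form a word.
\<close>
lemma mixed_minors_replicate_sum:
  fixes M :: "'q::finite \<Rightarrow> 'p::finite \<Rightarrow> 'p \<Rightarrow> real"
  shows "mixed_minors (replicate r (\<lambda>i j. \<Sum>\<alpha>\<in>UNIV. t \<alpha> * M \<alpha> i j)) =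
    (\<Sum>w | length w = r. (\<Prod>k<r. t (w ! k)) * mixed_minors (map M w))"
proof -
  have "mixed_minors (replicate r (\<lambda>i j. \<Sum>\<alpha>\<in>UNIV. t \<alpha> * M \<alpha> i j)) =
      (\<Sum>is | length is = r. \<Sum>js | length js = r. \<Sum>w | length w = r.
        (\<Prod>k<r. t (w ! k)) * (gen_kronecker is js * (\<Prod>k<r. M (w ! k) (is ! k) (js ! k))))"
    by (simp add: mixed_minors_def prod_sum_lists prod.distrib sum_distrib_left mult_ac)
  also have "\<dots> = (\<Sum>is | length is = r. \<Sum>w | length w = r. \<Sum>js | length js = r. 
        (\<Prod>k<r. t (w ! k)) * (gen_kronecker is js * (\<Prod>k<r. M (w ! k) (is ! k) (js ! k))))"
    by (rule sum.cong[OF refl sum.swap])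
  also have "\<dots> = (\<Sum>w | length w = r. \<Sum>is | length is = r. \<Sum>js | length js = r. 
        (\<Prod>k<r. t (w ! k)) * (gen_kronecker is js * (\<Prod>k<r. M (w ! k) (is ! k) (js ! k))))"
    by (rule sum.swap)
  also have "\<dots> = (\<Sum>w | length w = r. (\<Prod>k<r. t (w ! k)) * mixed_minors (map M w))"
    by (rule sum.cong) (auto simp: mixed_minors_def sum_distrib_left)
  finally show ?thesis .
qed

text \<open>
  Two words have the same multi-index exactly if they have the same multiset of letters.  Expressed
  through multisets, symmetry of an expression in its matrices says that it is constant on each of
  these sets of words.
\<close>
definition words_of :: "('q \<Rightarrow> nat) \<Rightarrow> 'q list set" where
  "words_of u = {w. count (mset w) = u}"

lemma length_eq_mi_size: "length w = mi_size (count (mset w))" for w :: "'q::finite list"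
proof (induction w)
  case (Cons a w)
  have "mi_size (count (mset (a # w))) = (\<Sum>\<alpha>\<in>UNIV. (if \<alpha> = a then 1 else 0) + count (mset w) \<alpha>)"
    unfolding mi_size_def by (rule sum.cong) auto
  then show ?case
    using Cons by (simp add: sum.distrib mi_size_def)
qed (simp add: mi_size_def)

lemma words_of_length: "w \<in> words_of u \<Longrightarrow> length w = mi_size u"
  using length_eq_mi_size by (auto simp: words_of_def)

lemma finite_words_of [simp]: "finite (words_of u)" for u :: "'q::finite \<Rightarrow> nat"
  by (rule finite_subset[OF _ finite_lists_of_length[of "mi_size u"]]) (auto dest: words_of_length)

lemma le_mi_size: "u \<alpha> \<le> mi_size u"
  unfolding mi_size_def by (rule member_le_sum) auto

lemma finite_mi_size_le [simp]: "finite {u :: 'q::finite \<Rightarrow> nat. mi_size u \<le> n}"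
proof (rule finite_subset)
  show "{u :: 'q \<Rightarrow> nat. mi_size u \<le> n} \<subseteq> (\<Pi>\<^sub>E \<alpha>\<in>UNIV. {..n})"
  proof
    fix u :: "'q \<Rightarrow> nat" assume "u \<in> {u. mi_size u \<le> n}"
    then have "u \<alpha> \<le> n" for \<alpha>
      using le_mi_size[of u \<alpha>] by simp
    then show "u \<in> (\<Pi>\<^sub>E \<alpha>\<in>UNIV. {..n})"
      by (simp add: PiE_def)
  qed
qed (auto intro: finite_PiE)

lemma finite_mi_size_eq [simp]: "finite {u :: 'q::finite \<Rightarrow> nat. mi_size u = n}"
  by (rule finite_subset[OF _ finite_mi_size_le[of n]]) auto

lemma sum_lists_by_content:
  fixes F :: "'q::finite list \<Rightarrow> 'b::comm_monoid_add"
  shows "(\<Sum>w | length w = r. F w) = (\<Sum>u | mi_size u = r. \<Sum>w\<in>words_of u. F w)"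
proof -
  have "(\<Sum>w | length w = r. F w) =
      (\<Sum>u | mi_size u = r. \<Sum>w | w \<in> {w. length w = r} \<and> count (mset w) = u. F w)"
    by (rule sum.group[symmetric]) (simp_all add: length_eq_mi_size[symmetric] image_subset_iff)
  also have "\<dots> = (\<Sum>u | mi_size u = r. \<Sum>w\<in>words_of u. F w)"
    by (intro sum.cong) (auto simp: words_of_def length_eq_mi_size)
  finally show ?thesis .
qed

lemma prod_over_word:
  fixes t :: "'q::finite \<Rightarrow> real"
  shows "(\<Prod>k<length w. t (w ! k)) = (\<Prod>\<alpha>\<in>UNIV. t \<alpha> ^ count (mset w) \<alpha>)"
proof (induction w)
  case (Cons a w)
  have "(\<Prod>\<alpha>\<in>UNIV. t \<alpha> ^ count (mset (a # w)) \<alpha>) =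
      (\<Prod>\<alpha>\<in>UNIV. (if \<alpha> = a then t \<alpha> else 1) * t \<alpha> ^ count (mset w) \<alpha>)"
    by (rule prod.cong) auto
  then show ?case
    using Cons by (simp add: prod.lessThan_Suc_shift prod.distrib del: prod.lessThan_Suc)
qed simp

lemma multinom_nonzero: "multinom r u \<noteq> 0"
  by (simp add: multinom_def)

text \<open>
  This is where multinomial coefficients enter: the words with multi-index \<open>u\<close> are the arrangements
  of one multiset.
\<close>
lemma card_words_of: "real (card (words_of u)) = multinom (mi_size u) u"
  for u :: "'q::finite \<Rightarrow> nat"
proof -
  define X where "X = Abs_multiset u"
  have u: "count X = u"
    unfolding X_def by (rule count_Abs_multiset) simp
  have "words_of u = permutations_of_multiset X"
    using u by (auto simp: words_of_def permutations_of_multiset_def multiset_eq_iff fun_eq_iff)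
  moreover have "size X = mi_size u"
  proof -
    obtain w where "mset w = X"
      using ex_mset by blast
    then show ?thesis
      using length_eq_mi_size[of w] u by auto
  qed
  moreover have "(\<Prod>x\<in>set_mset X. fact (count X x)) = (\<Prod>x\<in>UNIV. fact (u x) :: nat)"
    using u by (intro prod.mono_neutral_cong_left) (auto simp: not_in_iff)
  ultimately have "card (words_of u) * (\<Prod>x\<in>UNIV. fact (u x)) = fact (mi_size u)"
    using card_permutations_of_multiset_aux[of X] by simp
  then have "real (card (words_of u) * (\<Prod>x\<in>UNIV. fact (u x))) = real (fact (mi_size u))"
    by (rule arg_cong)
  then have "real (card (words_of u)) * (\<Prod>x\<in>UNIV. fact (u x)) = fact (mi_size u)"
    by simp
  then show ?thesis
    by (simp add: multinom_def eq_divide_eq)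
qed

lemma sum_words_of_symmetric:
  fixes G :: "'q::finite list \<Rightarrow> real"
  assumes "\<And>w w'. mset w = mset w' \<Longrightarrow> G w = G w'" and "w \<in> words_of u"
  shows "(\<Sum>w'\<in>words_of u. G w') = multinom (mi_size u) u * G w"
proof -
  have "G w' = G w" if "w' \<in> words_of u" for w'
    using that assms(2) by (intro assms(1)) (simp add: words_of_def multiset_eq_iff)
  then show ?thesis
    by (simp add: card_words_of)
qed

section \<open>The coefficients of the determinant\<close>

text \<open>
  By symmetry all summands agree, so this is \<open>1 / |u|!\<close> times a multinomial coefficient times a
  single mixed minor sum.
\<close>
definition sigma_formula :: "('q::finite \<Rightarrow> 'p::finite \<Rightarrow> 'p \<Rightarrow> real) \<Rightarrow> ('q \<Rightarrow> nat) \<Rightarrow> real" where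
  "sigma_formula M u = (\<Sum>w\<in>words_of u. mixed_minors (map M w)) / fact (mi_size u)"

lemma sigma_formula_eq_0:
  fixes M :: "'q::finite \<Rightarrow> 'p::finite \<Rightarrow> 'p \<Rightarrow> real"
  assumes "CARD('p) < mi_size u"
  shows "sigma_formula M u = 0"
  using assms by (simp add: sigma_formula_def mixed_minors_eq_0 words_of_length)

lemma det_expansion:
  fixes M :: "'q::finite \<Rightarrow> 'p::finite \<Rightarrow> 'p \<Rightarrow> real"
  shows "det (\<chi> i j. (if i = j then 1 else 0) + (\<Sum>\<alpha>\<in>UNIV. t \<alpha> * M \<alpha> i j)) =
    (\<Sum>u | mi_size u \<le> CARD('p). sigma_formula M u * (\<Prod>\<alpha>\<in>UNIV. t \<alpha> ^ u \<alpha>))"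
proof -
  let ?f = "\<lambda>u. sigma_formula M u * (\<Prod>\<alpha>\<in>UNIV. t \<alpha> ^ u \<alpha>)"
  have "mixed_minors (replicate r (\<lambda>i j. \<Sum>\<alpha>\<in>UNIV. t \<alpha> * M \<alpha> i j)) / fact r = (\<Sum>u | mi_size u = r. ?f u)" for r
  proof -
    have "mixed_minors (replicate r (\<lambda>i j. \<Sum>\<alpha>\<in>UNIV. t \<alpha> * M \<alpha> i j)) / fact r =
        (\<Sum>u | mi_size u = r. (\<Sum>w\<in>words_of u. (\<Prod>k<r. t (w ! k)) * mixed_minors (map M w)) / fact r)"
      by (simp add: mixed_minors_replicate_sum sum_lists_by_content sum_divide_distrib)
    also have "\<dots> = (\<Sum>u | mi_size u = r. ?f u)"
    proof (rule sum.cong)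
      fix u :: "'q \<Rightarrow> nat" assume "u \<in> {u. mi_size u = r}"
      then have "(\<Prod>k<r. t (w ! k)) = (\<Prod>\<alpha>\<in>UNIV. t \<alpha> ^ u \<alpha>)" if "w \<in> words_of u" for w
        using prod_over_word[of t w] that words_of_length[OF that] by (simp add: words_of_def)
      then show "(\<Sum>w\<in>words_of u. (\<Prod>k<r. t (w ! k)) * mixed_minors (map M w)) / fact r = ?f u"
        using \<open>u \<in> _\<close> by (simp add: sigma_formula_def sum_distrib_left[symmetric])
    qed simp
    finally show ?thesis .
  qed
  then have "det (\<chi> i j. (if i = j then 1 else 0) + (\<Sum>\<alpha>\<in>UNIV. t \<alpha> * M \<alpha> i j)) =
      (\<Sum>r\<le>CARD('p). \<Sum>u | u \<in> {u. mi_size u \<le> CARD('p)} \<and> mi_size u = r. ?f u)"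
    unfolding det_one_plus by (intro sum.cong) (auto intro!: sum.cong)
  also have "\<dots> = (\<Sum>u | mi_size u \<le> CARD('p). ?f u)"
    by (rule sum.group) auto
  finally show ?thesis .
qed

text \<open>
  The statement is prepared for induction on the set \<open>S\<close> of variables: the exponent vectors live on
  all of \<open>'q\<close>, but those in \<open>F\<close> are told apart by their values on \<open>S\<close>.  To remove the variable \<open>a\<close>,
  regard the sum as a polynomial in \<open>t a\<close>; each of its coefficients is a sum of the same kind, over
  the vectors with a given exponent at \<open>a\<close>, and these vectors are already told apart on \<open>S\<close>.
\<close>
lemma monomials_independent_on:
  fixes s :: "('q::finite \<Rightarrow> nat) \<Rightarrow> real"
  assumes "finite S" "finite F"
    and "\<And>u v. u \<in> F \<Longrightarrow> v \<in> F \<Longrightarrow> (\<And>\<alpha>. \<alpha> \<in> S \<Longrightarrow> u \<alpha> = v \<alpha>) \<Longrightarrow> u = v"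
    and "\<And>t. (\<Sum>u\<in>F. s u * (\<Prod>\<alpha>\<in>S. t \<alpha> ^ u \<alpha>)) = 0"
    and "u \<in> F"
  shows "s u = 0"
  using assms
proof (induction S arbitrary: F u rule: finite_induct)
  case empty
  then have "F = {u}"
    by auto
  then show ?case
    using empty.prems(3) by simp
next
  case (insert a S)
  obtain N where N: "\<And>v. v \<in> F \<Longrightarrow> v a \<le> N"
    using finite_nat_set_iff_bounded_le[of "(\<lambda>v. v a) ` F"] \<open>finite F\<close> by auto
  have slice: "(\<Sum>v | v \<in> F \<and> v a = k. s v * (\<Prod>\<alpha>\<in>S. t \<alpha> ^ v \<alpha>)) = 0" if "k \<le> N" for k t
  proof -
    have "(\<Sum>k\<le>N. (\<Sum>v | v \<in> F \<and> v a = k. s v * (\<Prod>\<alpha>\<in>S. t \<alpha> ^ v \<alpha>)) * x ^ k) = 0" for x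
    proof -
      \<comment> \<open>the variables other than \<open>a\<close> stay at \<open>t\<close> while the variable \<open>a\<close> runs through all \<open>x\<close>\<close>
      have S: "(\<Prod>\<alpha>\<in>S. (t(a := x)) \<alpha> ^ v \<alpha>) = (\<Prod>\<alpha>\<in>S. t \<alpha> ^ v \<alpha>)" for v
        using insert.hyps by (intro prod.cong) auto
      have "0 = (\<Sum>v\<in>F. s v * (\<Prod>\<alpha>\<in>insert a S. (t(a := x)) \<alpha> ^ v \<alpha>))"
        using insert.prems(3)[of "t(a := x)"] by simp
      also have "\<dots> = (\<Sum>v\<in>F. s v * (\<Prod>\<alpha>\<in>S. t \<alpha> ^ v \<alpha>) * x ^ v a)"
        using insert.hyps S by (simp add: mult_ac del: fun_upd_apply) (simp add: mult_ac)
      also have "\<dots> = (\<Sum>k\<le>N. \<Sum>v | v \<in> F \<and> v a = k. s v * (\<Prod>\<alpha>\<in>S. t \<alpha> ^ v \<alpha>) * x ^ v a)"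
        using N \<open>finite F\<close> by (intro sum.group[symmetric]) auto
      also have "\<dots> = (\<Sum>k\<le>N. (\<Sum>v | v \<in> F \<and> v a = k. s v * (\<Prod>\<alpha>\<in>S. t \<alpha> ^ v \<alpha>)) * x ^ k)"
        by (simp add: sum_distrib_right)
      finally show ?thesis by simp
    qed
    then show ?thesis
      using polyfun_eq_0[of "\<lambda>k. \<Sum>v | v \<in> F \<and> v a = k. s v * (\<Prod>\<alpha>\<in>S. t \<alpha> ^ v \<alpha>)" N] that by blast
  qed
  show ?case
  proof (rule insert.IH[where F = "{v \<in> F. v a = u a}"])
    show "v = v'" if "v \<in> {v \<in> F. v a = u a}" "v' \<in> {v \<in> F. v a = u a}"
      "\<And>\<alpha>. \<alpha> \<in> S \<Longrightarrow> v \<alpha> = v' \<alpha>" for v v'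
      using that by (intro insert.prems(2)) auto
  qed (use insert.prems slice N in auto)
qed

lemma polynomial_coefficients_unique:
  fixes s s' :: "('q::finite \<Rightarrow> nat) \<Rightarrow> real"
  assumes "finite F" and "u \<in> F"
    and "\<And>t. (\<Sum>u\<in>F. s u * (\<Prod>\<alpha>\<in>UNIV. t \<alpha> ^ u \<alpha>)) = (\<Sum>u\<in>F. s' u * (\<Prod>\<alpha>\<in>UNIV. t \<alpha> ^ u \<alpha>))"
  shows "s u = s' u"
proof -
  have "s u - s' u = 0"
    by (rule monomials_independent_on[where S = UNIV and F = F and s = "\<lambda>u. s u - s' u"])
       (use assms in \<open>auto simp: left_diff_distrib sum_subtractf\<close>)
  then show ?thesis by simp
qed

section \<open>Doubled words\<close>

text \<open>
  The letters \<open>\<alpha>\<^sub>1, \<dots>, \<alpha>\<^sub>m\<close> of the inner sums in the theorem each carry two consecutive matrices.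
\<close>
fun doubled :: "'a list \<Rightarrow> 'a list" where
  "doubled [] = []"
| "doubled (a # as) = a # a # doubled as"

lemma length_doubled [simp]: "length (doubled as) = 2 * length as"
  by (induction as) auto

lemma nth_doubled: "k < length as \<Longrightarrow> doubled as ! (2 * k) = as ! k \<and> doubled as ! Suc (2 * k) = as ! k"
  by (induction as arbitrary: k) (auto simp: nth_Cons split: nat.splits)

lemma count_doubled [simp]: "count (mset (doubled as)) a = 2 * count (mset as) a"
  by (induction as) auto

lemma mi_size_double: "mi_size (\<lambda>\<alpha>. 2 * u \<alpha>) = 2 * mi_size u"
  by (simp add: mi_size_def sum_distrib_left)

lemma double_mi_half: "mi_even u \<Longrightarrow> (\<lambda>\<alpha>. 2 * mi_half u \<alpha>) = u"
  by (auto simp: mi_even_def mi_half_def)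

lemma mi_size_half: "mi_even u \<Longrightarrow> 2 * mi_size (mi_half u) = mi_size u"
  using mi_size_double[of "mi_half u"] by (simp add: double_mi_half)

lemma mi_size_Suc: "mi_size (u(\<alpha> := Suc (u \<alpha>))) = Suc (mi_size u)"
proof -
  have "u(\<alpha> := Suc (u \<alpha>)) = (\<lambda>\<beta>. (if \<beta> = \<alpha> then 1 else 0) + u \<beta>)"
    by auto
  then show ?thesis
    by (simp add: mi_size_def sum.distrib)
qed

lemma multinom_Suc:
  "multinom (Suc n) (u(\<alpha> := Suc (u \<alpha>))) = real (Suc n) / real (Suc (u \<alpha>)) * multinom n u"
proof -
  let ?R = "\<Prod>\<beta>\<in>UNIV - {\<alpha>}. fact (u \<beta>) :: real"
  have "(\<Prod>\<beta>\<in>UNIV. fact (u \<beta>)) = fact (u \<alpha>) * ?R"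
    by (rule prod.remove) auto
  moreover have "(\<Prod>\<beta>\<in>UNIV. fact ((u(\<alpha> := Suc (u \<alpha>))) \<beta>)) = fact (Suc (u \<alpha>)) * ?R"
    by (subst prod.remove[of _ \<alpha>]) auto
  ultimately show ?thesis
    unfolding multinom_def by (simp add: divide_simps)
qed

text \<open>
  Doubling turns the multi-index \<open>v\<close> into \<open>2 v\<close>.  All words on the left therefore lie in one class
  \<open>words_of u\<close>, on which \<open>G\<close> is constant, and the two multinomial coefficients are the numbers of
  words in the two classes.  The suffix \<open>s\<close> is empty for \<open>S\<^sub>r\<close> and \<open>T\<^sub>r\<close> and a single letter for
  \<open>T\<^sup>\<alpha>\<close>.
\<close>
lemma sum_doubled_class:
  fixes G :: "'q::finite list \<Rightarrow> real"
  assumes "\<And>w w'. mset w = mset w' \<Longrightarrow> G w = G w'"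
    and u: "\<And>\<alpha>. u \<alpha> = 2 * v \<alpha> + count (mset s) \<alpha>"
  shows "(\<Sum>as\<in>words_of v. G (doubled as @ s)) =
    multinom (mi_size v) v * inverse (multinom (mi_size u) u) * (\<Sum>w\<in>words_of u. G w)"
proof -
  have "G (doubled as @ s) = inverse (multinom (mi_size u) u) * (\<Sum>w\<in>words_of u. G w)"
    if "as \<in> words_of v" for as
  proof -
    have "count (mset (doubled as @ s)) = u"
      using that u by (auto simp: words_of_def)
    then have "(\<Sum>w\<in>words_of u. G w) = multinom (mi_size u) u * G (doubled as @ s)"
      by (intro sum_words_of_symmetric[OF assms(1)]) (auto simp: words_of_def)
    then show ?thesis
      using multinom_nonzero[of "mi_size u" u] by simp
  qed
  then show ?thesis
    by (simp add: card_words_of)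
qed

lemma sum_doubled:
  fixes G :: "'q::finite list \<Rightarrow> real"
  assumes "\<And>w w'. mset w = mset w' \<Longrightarrow> G w = G w'"
  shows "(\<Sum>as | length as = m. G (doubled as)) =
    (\<Sum>u | mi_even u \<and> mi_size u = 2 * m.
      multinom m (mi_half u) * inverse (multinom (2 * m) u) * (\<Sum>w\<in>words_of u. G w))"
proof -
  let ?c = "\<lambda>v u. multinom m v * inverse (multinom (2 * m) u) * (\<Sum>w\<in>words_of u. G w)"
  have "(\<Sum>as | length as = m. G (doubled as)) =
      (\<Sum>v | mi_size v = m. ?c v (\<lambda>\<alpha>. 2 * v \<alpha>))"
    unfolding sum_lists_by_content
  proof (rule sum.cong)
    fix v :: "'q \<Rightarrow> nat" assume "v \<in> {v. mi_size v = m}"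
    then show "(\<Sum>as\<in>words_of v. G (doubled as)) = ?c v (\<lambda>\<alpha>. 2 * v \<alpha>)"
      using sum_doubled_class[where G = G and u = "\<lambda>\<alpha>. 2 * v \<alpha>" and v = v and s = "[]", OF assms] by (simp add: mi_size_double)
  qed simp
  also have "\<dots> = (\<Sum>u | mi_even u \<and> mi_size u = 2 * m. ?c (mi_half u) u)"
    by (rule sum.reindex_bij_witness[where i = mi_half and j = "\<lambda>v \<alpha>. 2 * v \<alpha>"])
       (auto simp: double_mi_half mi_size_double dest: mi_size_half, auto simp: mi_half_def mi_even_def)
  finally show ?thesis .
qed

text \<open>
  A word \<open>doubled as @ [\<alpha>]\<close> with \<open>as\<close> of multi-index \<open>v\<close> has the multi-index of \<open>\<alpha>\<^sub>\<flat>(u)\<close> for the even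
  \<open>u = 2 v + 2 \<alpha>\<close>, and every even \<open>u\<close> with \<open>u \<alpha> \<noteq> 0\<close> arises in this way.  The coefficient belonging
  to the lower degree agrees with the one belonging to \<open>u\<close>, because raising the exponent of \<open>\<alpha>\<close>
  multiplies the multinomial coefficients of \<open>v\<close> and of \<open>2 v + \<alpha>\<close> by the same factor
  \<open>(n + 1) / (v \<alpha> + 1)\<close>.
\<close>
lemma sum_doubled_snoc:
  fixes G :: "'q::finite list \<Rightarrow> real"
  assumes sym: "\<And>w w'. mset w = mset w' \<Longrightarrow> G w = G w'"
  shows "(\<Sum>as | length as = n. G (doubled as @ [\<alpha>])) =
    (\<Sum>u | mi_even u \<and> mi_size u = 2 * Suc n.
      multinom (Suc n) (mi_half u) * inverse (multinom (2 * Suc n) u) *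
      at_flat (\<lambda>u. \<Sum>w\<in>words_of u. G w) \<alpha> u)"
proof -
  let ?c = "\<lambda>u. multinom (Suc n) (mi_half u) * inverse (multinom (2 * Suc n) u) *
      at_flat (\<lambda>u. \<Sum>w\<in>words_of u. G w) \<alpha> u"
  let ?up = "\<lambda>v \<beta>. 2 * (v(\<alpha> := Suc (v \<alpha>))) \<beta>"
  let ?down = "\<lambda>u. (mi_half u)(\<alpha> := mi_half u \<alpha> - 1)"
  have "(\<Sum>as | length as = n. G (doubled as @ [\<alpha>])) = (\<Sum>v | mi_size v = n. ?c (?up v))"
    unfolding sum_lists_by_content
  proof (rule sum.cong)
    fix v :: "'q \<Rightarrow> nat" assume v: "v \<in> {v. mi_size v = n}"
    \<comment> \<open>the multi-index of \<open>doubled as @ [\<alpha>]\<close>, that is \<open>\<alpha>\<^sub>\<flat>(?up v)\<close>\<close>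
    define v1 where "v1 = (\<lambda>\<beta>. 2 * v \<beta> + count (mset [\<alpha>]) \<beta>)"
    have v1: "v1 = (\<lambda>\<beta>. 2 * v \<beta>)(\<alpha> := Suc (2 * v \<alpha>))"
      by (auto simp: v1_def)
    have up: "?up v = v1(\<alpha> := Suc (v1 \<alpha>))"
      by (auto simp: v1)
    have half: "mi_half (?up v) = v(\<alpha> := Suc (v \<alpha>))"
      by (auto simp: mi_half_def)
    have size: "mi_size v1 = Suc (2 * n)"
      using v mi_size_Suc[of "\<lambda>\<beta>. 2 * v \<beta>" \<alpha>] by (simp add: v1 mi_size_double)
    have flat: "at_flat (\<lambda>u. \<Sum>w\<in>words_of u. G w) \<alpha> (?up v) = (\<Sum>w\<in>words_of v1. G w)"
      unfolding at_flat_def up by simp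
    have cancel: "real (Suc n) / real (Suc (v \<alpha>)) * x * inverse (real (Suc n) / real (Suc (v \<alpha>)) * y) = x * inverse y" for x y
      by (simp del: of_nat_Suc) (simp add: divide_inverse)
    have "multinom (Suc n) (v(\<alpha> := Suc (v \<alpha>))) = real (Suc n) / real (Suc (v \<alpha>)) * multinom n v"
      by (rule multinom_Suc)
    moreover have "multinom (2 * Suc n) (?up v) = real (Suc n) / real (Suc (v \<alpha>)) * multinom (Suc (2 * n)) v1"
    proof -
      have "multinom (2 * Suc n) (?up v) =
          real (Suc (Suc (2 * n))) / real (Suc (v1 \<alpha>)) * multinom (Suc (2 * n)) v1"
        using multinom_Suc[of "Suc (2 * n)" v1 \<alpha>] unfolding up by simp
      also have "real (Suc (Suc (2 * n))) / real (Suc (v1 \<alpha>)) = real (Suc n) / real (Suc (v \<alpha>))"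
        by (simp add: v1 divide_simps) (simp add: algebra_simps)
      finally show ?thesis .
    qed
    ultimately have coef: "multinom (Suc n) (mi_half (?up v)) * inverse (multinom (2 * Suc n) (?up v)) =
        multinom n v * inverse (multinom (Suc (2 * n)) v1)"
      unfolding half by (simp only: cancel)
    have "(\<Sum>as\<in>words_of v. G (doubled as @ [\<alpha>])) =
        multinom (mi_size v) v * inverse (multinom (mi_size v1) v1) * (\<Sum>w\<in>words_of v1. G w)"
      by (rule sum_doubled_class[OF sym]) (simp_all add: v1_def)
    also have "\<dots> = ?c (?up v)"
      unfolding coef flat size using v by simp
    finally show "(\<Sum>as\<in>words_of v. G (doubled as @ [\<alpha>])) = ?c (?up v)" .
  qed simp
  also have "\<dots> = (\<Sum>u | mi_even u \<and> mi_size u = 2 * Suc n \<and> u \<alpha> \<noteq> 0. ?c u)"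
  proof (rule sum.reindex_bij_witness[where i = ?down and j = ?up])
    fix u assume u: "u \<in> {u. mi_even u \<and> mi_size u = 2 * Suc n \<and> u \<alpha> \<noteq> 0}"
    then have "2 * mi_half u \<alpha> = u \<alpha>"
      using fun_cong[OF double_mi_half[of u], of \<alpha>] by simp
    then have nz: "mi_half u \<alpha> \<noteq> 0"
      using u by auto
    have down: "(?down u)(\<alpha> := Suc ((?down u) \<alpha>)) = mi_half u"
      using nz by auto
    show "?up (?down u) = u"
      unfolding down using u by (simp add: double_mi_half)
    have "Suc (mi_size (?down u)) = mi_size (mi_half u)"
      using mi_size_Suc[of "?down u" \<alpha>] unfolding down by simp
    then show "?down u \<in> {v. mi_size v = n}"
      using u mi_size_half[of u] by simp
  next
    fix v :: "'q \<Rightarrow> nat" assume v: "v \<in> {v. mi_size v = n}"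
    have "mi_size (?up v) = 2 * Suc n"
      using v by (simp only: mi_size_double mi_size_Suc mem_Collect_eq)
    then show "?up v \<in> {u. mi_even u \<and> mi_size u = 2 * Suc n \<and> u \<alpha> \<noteq> 0}"
      by (simp add: mi_even_def)
    show "?down (?up v) = v"
      by (auto simp: mi_half_def)
  qed simp
  \<comment> \<open>for \<open>u \<alpha> = 0\<close> the index \<open>\<alpha>\<^sub>\<flat>(u)\<close> has a negative entry and the summand vanishes\<close>
  also have "\<dots> = (\<Sum>u | mi_even u \<and> mi_size u = 2 * Suc n. ?c u)"
    by (rule sum.mono_neutral_left)
       (auto simp: at_flat_def intro: finite_subset[OF _ finite_mi_size_eq[of "2 * Suc n"]])
  finally show ?thesis .
qed

section \<open>Cofactors and derivatives of mixed minors\<close>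

text \<open>
  The coefficient of the entry \<open>(i, j)\<close> of a matrix put into one further slot.
\<close>
definition mixed_cofactor :: "('p::finite \<Rightarrow> 'p \<Rightarrow> real) list \<Rightarrow> 'p \<Rightarrow> 'p \<Rightarrow> real" where
  "mixed_cofactor Ms i j = (\<Sum>is | length is = length Ms. \<Sum>js | length js = length Ms.
     gen_kronecker (is @ [i]) (js @ [j]) * (\<Prod>k<length Ms. (Ms ! k) (is ! k) (js ! k)))"

lemma mixed_minors_snoc: "mixed_minors (Ms @ [X]) = (\<Sum>i\<in>UNIV. \<Sum>j\<in>UNIV. X i j * mixed_cofactor Ms i j)"
proof -
  let ?g = "\<lambda>is i js j. X i j * (gen_kronecker (is @ [i]) (js @ [j]) * (\<Prod>k<length Ms. (Ms ! k) (is ! k) (js ! k)))"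
  let ?L = "{is. length is = length Ms}"
  have "mixed_minors (Ms @ [X]) = (\<Sum>is\<in>?L. \<Sum>i\<in>UNIV. \<Sum>js\<in>?L. \<Sum>j\<in>UNIV. ?g is i js j)"
    unfolding mixed_minors_def length_append list.size add_0_right add_Suc_right sum_lists_snoc
    by (intro sum.cong) (auto simp: nth_append mult_ac)
  also have "\<dots> = (\<Sum>i\<in>UNIV. \<Sum>is\<in>?L. \<Sum>js\<in>?L. \<Sum>j\<in>UNIV. ?g is i js j)"
    by (rule sum.swap)
  also have "\<dots> = (\<Sum>i\<in>UNIV. \<Sum>is\<in>?L. \<Sum>j\<in>UNIV. \<Sum>js\<in>?L. ?g is i js j)"
    by (intro sum.cong refl sum.swap)
  also have "\<dots> = (\<Sum>i\<in>UNIV. \<Sum>j\<in>UNIV. \<Sum>is\<in>?L. \<Sum>js\<in>?L. ?g is i js j)"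
    by (intro sum.cong refl sum.swap)
  also have "\<dots> = (\<Sum>i\<in>UNIV. \<Sum>j\<in>UNIV. X i j * mixed_cofactor Ms i j)"
    by (simp add: mixed_cofactor_def sum_distrib_left)
  finally show ?thesis .
qed

text \<open>
  A cofactor is a mixed minor sum whose last matrix is a matrix unit.
\<close>
lemma mixed_cofactor_symmetric:
  assumes "mset Ms = mset Ns"
  shows "mixed_cofactor Ms i j = mixed_cofactor Ns i j"
proof -
  let ?U = "\<lambda>i' j'. if i' = i then if j' = j then 1 else 0 else 0 :: real"
  have "mixed_cofactor Ms i j = mixed_minors (Ms @ [?U])" for Ms
    by (simp add: mixed_minors_snoc sum.delta if_distrib[where f = "\<lambda>x. x * _"] cong: if_cong)
       (subst sum.remove[of _ i], auto)
  then show ?thesis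
    using mixed_minors_symmetric[of "Ms @ [?U]" "Ns @ [?U]"] assms by simp
qed

lemma prod_replace_factor:
  fixes f :: "nat \<Rightarrow> real"
  assumes "k < n"
  shows "(\<Prod>l<n. if l = k then a else f l) = a * (\<Prod>l\<in>{..<n} - {k}. f l)"
  using assms by (subst prod.remove[of _ k]) (auto intro!: prod.cong)

lemma mixed_minors_has_derivative:
  fixes M :: "real \<Rightarrow> 'q \<Rightarrow> 'p::finite \<Rightarrow> 'p \<Rightarrow> real"
  assumes "\<And>\<alpha> i j. ((\<lambda>\<tau>. M \<tau> \<alpha> i j) has_real_derivative M' \<alpha> i j) (at x)"
  shows "((\<lambda>\<tau>. mixed_minors (map (M \<tau>) w)) has_real_derivative
    (\<Sum>k<length w. mixed_minors ((map (M x) w)[k := M' (w ! k)]))) (at x)"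
proof -
  let ?L = "{is. length is = length w}"
  have upd: "(\<Prod>l<length w. ((map (M x) w)[k := M' (w ! k)] ! l) (is ! l) (js ! l)) =
      M' (w ! k) (is ! k) (js ! k) * (\<Prod>l\<in>{..<length w} - {k}. M x (w ! l) (is ! l) (js ! l))"
    if "k < length w" for k "is" js
  proof -
    have "(\<Prod>l<length w. ((map (M x) w)[k := M' (w ! k)] ! l) (is ! l) (js ! l)) =
        (\<Prod>l<length w. if l = k then M' (w ! k) (is ! k) (js ! k) else M x (w ! l) (is ! l) (js ! l))"
      by (rule prod.cong) (auto simp: nth_list_update)
    then show ?thesis
      using that by (simp add: prod_replace_factor)
  qed
  have "((\<lambda>\<tau>. mixed_minors (map (M \<tau>) w)) has_real_derivative
      (\<Sum>is\<in>?L. \<Sum>js\<in>?L. gen_kronecker is js * (\<Sum>k<length w. M' (w ! k) (is ! k) (js ! k) *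
        (\<Prod>l\<in>{..<length w} - {k}. M x (w ! l) (is ! l) (js ! l))))) (at x)"
    unfolding mixed_minors_def
    by (auto intro!: DERIV_sum DERIV_cmult has_field_derivative_prod assms)
  also have "(\<Sum>is\<in>?L. \<Sum>js\<in>?L. gen_kronecker is js * (\<Sum>k<length w. M' (w ! k) (is ! k) (js ! k) *
        (\<Prod>l\<in>{..<length w} - {k}. M x (w ! l) (is ! l) (js ! l)))) =
      (\<Sum>is\<in>?L. \<Sum>js\<in>?L. \<Sum>k<length w. gen_kronecker is js *
        (\<Prod>l<length w. ((map (M x) w)[k := M' (w ! k)] ! l) (is ! l) (js ! l)))"
    by (simp add: upd sum_distrib_left)
  also have "\<dots> = (\<Sum>is\<in>?L. \<Sum>k<length w. \<Sum>js\<in>?L. gen_kronecker is js *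
        (\<Prod>l<length w. ((map (M x) w)[k := M' (w ! k)] ! l) (is ! l) (js ! l)))"
    by (intro sum.cong refl sum.swap)
  also have "\<dots> = (\<Sum>k<length w. \<Sum>is\<in>?L. \<Sum>js\<in>?L. gen_kronecker is js *
        (\<Prod>l<length w. ((map (M x) w)[k := M' (w ! k)] ! l) (is ! l) (js ! l)))"
    by (rule sum.swap)
  also have "\<dots> = (\<Sum>k<length w. mixed_minors ((map (M x) w)[k := M' (w ! k)]))"
    by (simp add: mixed_minors_def)
  finally show ?thesis .
qed

text \<open>
  Removing the letter at a fixed position is a bijection from the words with multi-index \<open>u\<close> onto the
  pairs of a letter \<open>\<alpha>\<close> with \<open>u \<alpha> \<noteq> 0\<close> and a word with multi-index \<open>\<alpha>\<^sub>\<flat>(u)\<close>.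
\<close>
lemma sum_words_of_extract_letter:
  fixes H :: "'q::finite list \<Rightarrow> 'q \<Rightarrow> real"
  assumes "k < mi_size u"
  shows "(\<Sum>w\<in>words_of u. H (take k w @ drop (Suc k) w) (w ! k)) =
    (\<Sum>\<alpha>\<in>UNIV. at_flat (\<lambda>u. \<Sum>w\<in>words_of u. H w \<alpha>) \<alpha> u)"
proof -
  let ?pre = "\<lambda>\<alpha>. words_of (u(\<alpha> := u \<alpha> - 1))"
  have "(\<Sum>\<alpha>\<in>UNIV. at_flat (\<lambda>u. \<Sum>w\<in>words_of u. H w \<alpha>) \<alpha> u) =
      (\<Sum>\<alpha> | u \<alpha> \<noteq> 0. \<Sum>w\<in>?pre \<alpha>. H w \<alpha>)"
    by (rule sum.mono_neutral_cong_right) (auto simp: at_flat_def)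
  also have "\<dots> = (\<Sum>(\<alpha>, w)\<in>Sigma {\<alpha>. u \<alpha> \<noteq> 0} ?pre. H w \<alpha>)"
    by (rule sum.Sigma) auto
  also have "\<dots> = (\<Sum>w\<in>words_of u. H (take k w @ drop (Suc k) w) (w ! k))"
  proof (rule sum.reindex_bij_witness[
      where i = "\<lambda>w. (w ! k, take k w @ drop (Suc k) w)" and j = "\<lambda>(\<alpha>, w). take k w @ \<alpha> # drop k w"])
    fix w assume w: "w \<in> words_of u"
    then have k: "k < length w"
      using assms words_of_length[OF w] by simp
    have split: "w = take k w @ w ! k # drop (Suc k) w"
      using k by (rule id_take_nth_drop)
    have "mset w = mset (take k w @ drop (Suc k) w) + {#w ! k#}"
      by (subst split) simp
    then have cnt: "u = count (mset (take k w @ drop (Suc k) w) + {#w ! k#})"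
      using w by (auto simp: words_of_def)
    show "(w ! k, take k w @ drop (Suc k) w) \<in> Sigma {\<alpha>. u \<alpha> \<noteq> 0} ?pre"
      unfolding cnt by (auto simp: words_of_def)
    show "(\<lambda>(\<alpha>, w). take k w @ \<alpha> # drop k w) (w ! k, take k w @ drop (Suc k) w) = w"
      using k split by simp
  next
    fix aw assume "aw \<in> Sigma {\<alpha>. u \<alpha> \<noteq> 0} ?pre"
    then obtain \<alpha> w where aw: "aw = (\<alpha>, w)" "u \<alpha> \<noteq> 0" "w \<in> ?pre \<alpha>"
      by auto
    have u: "u = (u(\<alpha> := u \<alpha> - 1))(\<alpha> := Suc ((u(\<alpha> := u \<alpha> - 1)) \<alpha>))"
      using aw by auto
    have "mi_size u = Suc (mi_size (u(\<alpha> := u \<alpha> - 1)))"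
      by (subst u) (rule mi_size_Suc)
    then have k: "k \<le> length w"
      using assms words_of_length[OF aw(3)] by simp
    then show "(\<lambda>w. (w ! k, take k w @ drop (Suc k) w)) ((\<lambda>(\<alpha>, w). take k w @ \<alpha> # drop k w) aw) = aw"
      by (simp add: aw nth_append Suc_diff_le)
    have "mset (take k w @ \<alpha> # drop k w) = mset (take k w @ drop k w) + {#\<alpha>#}"
      by (simp del: append_take_drop_id)
    then have "count (mset (take k w @ \<alpha> # drop k w)) = u"
      using aw by (auto simp: words_of_def fun_eq_iff)
    then show "(\<lambda>(\<alpha>, w). take k w @ \<alpha> # drop k w) aw \<in> words_of u"
      by (simp add: aw words_of_def)
    show "H (take k ((\<lambda>(\<alpha>, w). take k w @ \<alpha> # drop k w) aw) @ drop (Suc k) ((\<lambda>(\<alpha>, w). take k w @ \<alpha> # drop k w) aw))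
        (((\<lambda>(\<alpha>, w). take k w @ \<alpha> # drop k w) aw) ! k) = (case aw of (\<alpha>, w) \<Rightarrow> H w \<alpha>)"
      using k by (simp add: aw nth_append Suc_diff_le)
  qed
  finally show ?thesis by simp
qed

text \<open>
  The product rule differentiates one slot at a time.  By symmetry the differentiated slot may be
  moved to the end, so that all \<open>|u|\<close> slots contribute equally; this factor turns \<open>1 / |u|!\<close> into
  \<open>1 / (|u| - 1)!\<close>, which is the normalization for \<open>\<alpha>\<^sub>\<flat>(u)\<close>.
\<close>
lemma sigma_formula_has_derivative:
  fixes M :: "real \<Rightarrow> 'q::finite \<Rightarrow> 'p::finite \<Rightarrow> 'p \<Rightarrow> real"
  assumes "\<And>\<alpha> i j. ((\<lambda>\<tau>. M \<tau> \<alpha> i j) has_real_derivative M' \<alpha> i j) (at x)"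
  shows "((\<lambda>\<tau>. sigma_formula (M \<tau>) u) has_real_derivative
    (\<Sum>\<alpha>\<in>UNIV. at_flat (\<lambda>v. (\<Sum>w\<in>words_of v. mixed_minors (map (M x) w @ [M' \<alpha>])) / fact (mi_size v)) \<alpha> u)) (at x)"
proof -
  let ?H = "\<lambda>w \<alpha>. mixed_minors (map (M x) w @ [M' \<alpha>])"
  let ?D = "\<Sum>\<alpha>\<in>UNIV. at_flat (\<lambda>v. \<Sum>w\<in>words_of v. ?H w \<alpha>) \<alpha> u"
  have slot: "mixed_minors ((map (M x) w)[k := M' (w ! k)]) = ?H (take k w @ drop (Suc k) w) (w ! k)"
    if "k < length w" for k w
    by (rule mixed_minors_symmetric) (use that in \<open>simp add: upd_conv_take_nth_drop take_map drop_map\<close>)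
  have "((\<lambda>\<tau>. sigma_formula (M \<tau>) u) has_real_derivative
      (\<Sum>w\<in>words_of u. \<Sum>k<length w. mixed_minors ((map (M x) w)[k := M' (w ! k)])) / fact (mi_size u)) (at x)"
    unfolding sigma_formula_def by (intro DERIV_cdivide DERIV_sum mixed_minors_has_derivative assms)
  also have "(\<Sum>w\<in>words_of u. \<Sum>k<length w. mixed_minors ((map (M x) w)[k := M' (w ! k)])) =
      (\<Sum>w\<in>words_of u. \<Sum>k<mi_size u. ?H (take k w @ drop (Suc k) w) (w ! k))"
    by (intro sum.cong) (auto simp: words_of_length slot)
  also have "\<dots> = (\<Sum>k<mi_size u. \<Sum>w\<in>words_of u. ?H (take k w @ drop (Suc k) w) (w ! k))"
    by (rule sum.swap)
  also have "\<dots> = real (mi_size u) * ?D"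
    using sum_words_of_extract_letter[of _ u ?H] by simp
  finally have "((\<lambda>\<tau>. sigma_formula (M \<tau>) u) has_real_derivative
      (\<Sum>\<alpha>\<in>UNIV. real (mi_size u) * at_flat (\<lambda>v. \<Sum>w\<in>words_of v. ?H w \<alpha>) \<alpha> u / fact (mi_size u))) (at x)"
    by (simp only: sum_distrib_left sum_divide_distrib)
  also have "(\<Sum>\<alpha>\<in>UNIV. real (mi_size u) * at_flat (\<lambda>v. \<Sum>w\<in>words_of v. ?H w \<alpha>) \<alpha> u / fact (mi_size u)) =
      (\<Sum>\<alpha>\<in>UNIV. at_flat (\<lambda>v. (\<Sum>w\<in>words_of v. ?H w \<alpha>) / fact (mi_size v)) \<alpha> u)"
  proof (rule sum.cong)
    fix \<alpha>
    show "real (mi_size u) * at_flat (\<lambda>v. \<Sum>w\<in>words_of v. ?H w \<alpha>) \<alpha> u / fact (mi_size u) =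
        at_flat (\<lambda>v. (\<Sum>w\<in>words_of v. ?H w \<alpha>) / fact (mi_size v)) \<alpha> u"
    proof (cases "u \<alpha> = 0")
      case False
      then have "u = (u(\<alpha> := u \<alpha> - 1))(\<alpha> := Suc ((u(\<alpha> := u \<alpha> - 1)) \<alpha>))"
        by auto
      then have "mi_size u = Suc (mi_size (u(\<alpha> := u \<alpha> - 1)))"
        using mi_size_Suc by metis
      then show ?thesis
        using False by (simp add: at_flat_def del: of_nat_Suc)
    qed (simp add: at_flat_def)
  qed simp
  finally show ?thesis .
qed

section \<open>Endomorphisms and their entries\<close>

lemma orthonormal_expansion:
  assumes "orthonormal_basis e"
  shows "x = (\<Sum>i\<in>UNIV. (e i \<bullet> x) *\<^sub>R e i)"
proof -
  let ?d = "x - (\<Sum>i\<in>UNIV. (e i \<bullet> x) *\<^sub>R e i)"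
  have "e k \<bullet> ?d = 0" for k
    using assms
    by (simp add: orthonormal_basis_def inner_diff_right inner_sum_right
        if_distrib[where f = "\<lambda>c. _ * c"] cong: if_cong)
  then have "orthogonal ?d y" if "y \<in> range e" for y
    using that by (auto simp: orthogonal_def inner_commute)
  moreover have "?d \<in> span (range e)"
    using assms by (simp add: orthonormal_basis_def)
  ultimately have "orthogonal ?d ?d"
    by (rule orthogonal_to_span[rotated])
  then show ?thesis
    by (simp add: orthogonal_self)
qed

lemma entry_endo_of_entries:
  assumes "orthonormal_basis e"
  shows "entry e (endo_of_entries e M) i j = M i j"
proof -
  have "bounded_linear (\<lambda>x. \<Sum>i\<in>UNIV. (\<Sum>j\<in>UNIV. M i j * (e j \<bullet> x)) *\<^sub>R e i)"
    by (intro bounded_linear_sum bounded_linear_scaleR_const bounded_linear_const_mult bounded_linear_inner_right)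
  then show ?thesis
    using assms
    by (simp add: entry_def endo_of_entries_def bounded_linear_Blinfun_apply orthonormal_basis_def
        inner_sum_right if_distrib[where f = "\<lambda>c. _ * c"] cong: if_cong)
qed

lemma endo_eqI:
  assumes e: "orthonormal_basis e" and "\<And>i j. entry e A i j = entry e B i j"
  shows "A = B"
proof (rule blinfun_eqI)
  fix x
  have "blinfun_apply A (e j) = blinfun_apply B (e j)" for j
    using orthonormal_expansion[OF e, of "blinfun_apply A (e j)"]
      orthonormal_expansion[OF e, of "blinfun_apply B (e j)"] assms(2) by (simp add: entry_def)
  then show "blinfun_apply A x = blinfun_apply B x"
    by (subst (1 2) orthonormal_expansion[OF e, of x]) (simp add: blinfun.sum_right blinfun.scaleR_right)
qed

lemma entry_add: "entry e (A + B) i j = entry e A i j + entry e B i j"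
  by (simp add: entry_def blinfun.add_left inner_add_right)

lemma entry_scaleR: "entry e (c *\<^sub>R A) i j = c * entry e A i j"
  by (simp add: entry_def blinfun.scaleR_left)

lemma entry_sum: "entry e (\<Sum>x\<in>X. F x) i j = (\<Sum>x\<in>X. entry e (F x) i j)"
  by (simp add: entry_def blinfun.sum_left inner_sum_right)

lemma entry_compose:
  assumes "orthonormal_basis e"
  shows "entry e (A o\<^sub>L B) i j = (\<Sum>k\<in>UNIV. entry e A i k * entry e B k j)"
  unfolding entry_def blinfun_apply_blinfun_compose
  by (subst orthonormal_expansion[OF assms, of "blinfun_apply B (e j)"])
     (simp add: blinfun.sum_right blinfun.scaleR_right inner_sum_right mult.commute)

lemma endo_trace_compose:
  assumes "orthonormal_basis e"
  shows "endo_trace e (A o\<^sub>L B) = (\<Sum>i\<in>UNIV. \<Sum>j\<in>UNIV. entry e A i j * entry e B j i)"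
  by (simp add: endo_trace_def trace_def entry_compose[OF assms])

section \<open>The functions \<open>\<sigma>\<^sub>u\<close> and the Newton transformation\<close>

abbreviation entries :: "('p \<Rightarrow> 'v::real_inner) \<Rightarrow> ('v \<Rightarrow>\<^sub>L 'v)^'q \<Rightarrow> 'q \<Rightarrow> 'p \<Rightarrow> 'p \<Rightarrow> real" where
  "entries e A \<equiv> \<lambda>\<alpha>. entry e (A $ \<alpha>)"

lemma sigma_coeff_eq:
  fixes e :: "'p::finite \<Rightarrow> 'v::real_inner" and A :: "('v \<Rightarrow>\<^sub>L 'v)^'q::finite"
  assumes "orthonormal_basis e"
  shows "sigma_coeff e A = sigma_formula (entries e A)"
  unfolding sigma_coeff_def
proof (rule the_equality)
  have "entry e id_blinfun i j = (if i = j then 1 else 0)" for i j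
    using assms by (simp add: entry_def orthonormal_basis_def)
  then have det: "endo_det e (id_blinfun + (\<Sum>\<alpha>\<in>UNIV. t \<alpha> *\<^sub>R A $ \<alpha>)) =
      (\<Sum>u | mi_size u \<le> CARD('p). sigma_formula (entries e A) u * (\<Prod>\<alpha>\<in>UNIV. t \<alpha> ^ u \<alpha>))" for t
    using det_expansion[of t "entries e A"]
    by (simp add: endo_det_def entry_add entry_sum entry_scaleR)
  then show "(\<forall>u. CARD('p) < mi_size u \<longrightarrow> sigma_formula (entries e A) u = 0) \<and>
    (\<forall>t. endo_det e (id_blinfun + (\<Sum>\<alpha>\<in>UNIV. t \<alpha> *\<^sub>R A $ \<alpha>)) =
      (\<Sum>u | mi_size u \<le> CARD('p). sigma_formula (entries e A) u * (\<Prod>\<alpha>\<in>UNIV. t \<alpha> ^ u \<alpha>)))"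
    by (simp add: sigma_formula_eq_0)
  fix s
  assume s: "(\<forall>u. CARD('p) < mi_size u \<longrightarrow> s u = 0) \<and>
    (\<forall>t. endo_det e (id_blinfun + (\<Sum>\<alpha>\<in>UNIV. t \<alpha> *\<^sub>R A $ \<alpha>)) =
      (\<Sum>u | mi_size u \<le> CARD('p). s u * (\<Prod>\<alpha>\<in>UNIV. t \<alpha> ^ u \<alpha>)))"
  show "s = sigma_formula (entries e A)"
  proof
    fix u
    show "s u = sigma_formula (entries e A) u"
    proof (cases "CARD('p) < mi_size u")
      case True
      then show ?thesis using s by (simp add: sigma_formula_eq_0)
    next
      case False
      show ?thesis
        by (rule polynomial_coefficients_unique[where F = "{u. mi_size u \<le> CARD('p)}"])
           (use False s det in auto)
    qed
  qed
qed

text \<open>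
  The cofactor indices are transposed relative to the entry, because \<open>tr(BT)\<close> pairs the entry
  \<open>(i, j)\<close> of \<open>B\<close> with the entry \<open>(j, i)\<close> of \<open>T\<close>.
\<close>
definition newton_formula ::
  "('p::finite \<Rightarrow> 'v::real_inner) \<Rightarrow> ('v \<Rightarrow>\<^sub>L 'v)^'q::finite \<Rightarrow> ('q \<Rightarrow> nat) \<Rightarrow> ('v \<Rightarrow>\<^sub>L 'v)" where
  "newton_formula e A u = endo_of_entries e (\<lambda>i j.
     (\<Sum>w\<in>words_of u. mixed_cofactor (map (entries e A) w) j i) / fact (mi_size u))"

lemma trace_newton_formula:
  assumes "orthonormal_basis e"
  shows "endo_trace e (B o\<^sub>L newton_formula e A u) =
    (\<Sum>w\<in>words_of u. mixed_minors (map (entries e A) w @ [entry e B])) / fact (mi_size u)"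
proof -
  let ?C = "\<lambda>w. mixed_cofactor (map (entries e A) w)"
  have "(\<Sum>w\<in>words_of u. mixed_minors (map (entries e A) w @ [entry e B])) =
      (\<Sum>i\<in>UNIV. \<Sum>w\<in>words_of u. \<Sum>j\<in>UNIV. entry e B i j * ?C w i j)"
    unfolding mixed_minors_snoc by (rule sum.swap)
  also have "\<dots> = (\<Sum>i\<in>UNIV. \<Sum>j\<in>UNIV. \<Sum>w\<in>words_of u. entry e B i j * ?C w i j)"
    by (intro sum.cong refl sum.swap)
  finally show ?thesis
    by (simp add: endo_trace_compose newton_formula_def entry_endo_of_entries assms
        sum_distrib_left sum_divide_distrib)
qed

lemma endo_trace_0: "endo_trace e 0 = 0" "endo_trace e (B o\<^sub>L 0) = 0" "endo_trace e (0 o\<^sub>L B) = 0"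
  by (simp_all add: endo_trace_def trace_def entry_def)

lemma is_gen_newton_newton_formula:
  fixes e :: "'p::finite \<Rightarrow> 'v::real_inner" and A :: "('v \<Rightarrow>\<^sub>L 'v)^'q::finite"
  assumes e: "orthonormal_basis e"
  shows "is_gen_newton e A (newton_formula e A)"
  unfolding is_gen_newton_def
proof (intro allI impI)
  fix u :: "'q \<Rightarrow> nat" and \<epsilon> :: real and c :: "real \<Rightarrow> ('v \<Rightarrow>\<^sub>L 'v)^'q"
  assume "0 < \<epsilon>" and c: "smooth_curve_on {-\<epsilon><..<\<epsilon>} c \<and> c 0 = A"
  define C where "C = vector_derivative c (at 0)"
  obtain D where "D 0 = c" and "\<forall>k. \<forall>t\<in>{-\<epsilon><..<\<epsilon>}. (D k has_vector_derivative D (Suc k) t) (at t)"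
    using c unfolding smooth_curve_on_def by auto
  then have "(c has_vector_derivative D 1 0) (at 0)"
    using \<open>0 < \<epsilon>\<close> by (metis One_nat_def greaterThanLessThan_iff neg_less_0_iff_less)
  then have vd: "(c has_vector_derivative C) (at 0)"
    unfolding C_def by (metis vector_derivative_at)
  have entry_deriv: "((\<lambda>\<tau>. entries e (c \<tau>) \<alpha> i j) has_real_derivative entry e (C $ \<alpha>) i j) (at 0)" for \<alpha> i j
  proof -
    have "bounded_linear (\<lambda>X :: ('v \<Rightarrow>\<^sub>L 'v)^'q. e i \<bullet> blinfun_apply (X $ \<alpha>) (e j))"
      by (intro bounded_linear_compose[OF bounded_linear_inner_right]
          bounded_linear_compose[OF blinfun.bounded_linear_left] bounded_linear_vec_nth)
    from bounded_linear.has_vector_derivative[OF this vd] show ?thesis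
      by (simp add: entry_def has_real_derivative_iff_has_vector_derivative)
  qed
  have "at_flat (\<lambda>v. (\<Sum>w\<in>words_of v. mixed_minors (map (entries e A) w @ [entry e (C $ \<alpha>)])) / fact (mi_size v)) \<alpha> u =
      endo_trace e (C $ \<alpha> o\<^sub>L at_flat (newton_formula e A) \<alpha> u)" for \<alpha>
    by (simp add: at_flat_def trace_newton_formula[OF e] endo_trace_0)
  then show "((\<lambda>\<tau>. sigma_coeff e (c \<tau>) u) has_real_derivative
      (\<Sum>\<alpha>\<in>UNIV. endo_trace e (vector_derivative c (at 0) $ \<alpha> o\<^sub>L at_flat (newton_formula e A) \<alpha> u))) (at 0)"
    using sigma_formula_has_derivative[where M = "\<lambda>\<tau>. entries e (c \<tau>)" and M' = "\<lambda>\<alpha>. entry e (C $ \<alpha>)"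
        and x = 0 and u = u, OF entry_deriv] c
    by (simp add: sigma_coeff_eq[OF e] C_def)
qed

text \<open>
  Moving only \<open>A\<^sub>\<alpha>\<close>, in a direction \<open>B\<close>, in the defining property at \<open>u = v + \<alpha>\<close> isolates the single
  trace \<open>tr(B T\<^sub>v)\<close>; as \<open>B\<close> is arbitrary, these traces determine \<open>T\<^sub>v\<close>.
\<close>
lemma is_gen_newton_unique:
  fixes e :: "'p::finite \<Rightarrow> 'v::real_inner" and A :: "('v \<Rightarrow>\<^sub>L 'v)^'q::finite"
  assumes e: "orthonormal_basis e" and T: "is_gen_newton e A T" and T': "is_gen_newton e A T'"
  shows "T = T'"
proof
  fix v
  obtain \<alpha> :: 'q where True by simp
  define u where "u = v(\<alpha> := Suc (v \<alpha>))"
  have tr: "endo_trace e (B o\<^sub>L T v) = endo_trace e (B o\<^sub>L T' v)" for B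
  proof -
    define c where "c = (\<lambda>\<tau> :: real. A + \<tau> *\<^sub>R axis \<alpha> B)"
    have c_deriv: "(c has_vector_derivative axis \<alpha> B) (at t)" for t
      unfolding c_def by (auto intro!: derivative_eq_intros)
    have smooth: "smooth_curve_on {-1<..<1} c"
      unfolding smooth_curve_on_def
      by (rule exI[where x = "\<lambda>k. if k = 0 then c else if k = 1 then (\<lambda>t. axis \<alpha> B) else (\<lambda>t. 0)"])
         (auto simp: c_deriv)
    have sum: "(\<Sum>\<beta>\<in>UNIV. endo_trace e (vector_derivative c (at 0) $ \<beta> o\<^sub>L at_flat R \<beta> u)) =
        endo_trace e (B o\<^sub>L R v)" for R
    proof -
      have "(\<Sum>\<beta>\<in>UNIV. endo_trace e (vector_derivative c (at 0) $ \<beta> o\<^sub>L at_flat R \<beta> u)) =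
          (\<Sum>\<beta>\<in>UNIV. if \<beta> = \<alpha> then endo_trace e (B o\<^sub>L R v) else 0)"
        by (rule sum.cong)
           (auto simp: vector_derivative_at[OF c_deriv] axis_def at_flat_def u_def endo_trace_0)
      then show ?thesis by simp
    qed
    have D: "((\<lambda>\<tau>. sigma_coeff e (c \<tau>) u) has_real_derivative endo_trace e (B o\<^sub>L R v)) (at 0)"
      if "is_gen_newton e A R" for R
      using that[unfolded is_gen_newton_def, rule_format, of 1 c u] smooth
      by (simp add: sum) (simp add: c_def)
    show ?thesis
      using DERIV_unique[OF D[OF T] D[OF T']] .
  qed
  show "T v = T' v"
  proof (rule endo_eqI[OF e])
    fix i j :: 'p
    \<comment> \<open>the matrix unit with its entry at \<open>(j, i)\<close>, so that the trace reads off the entry \<open>(i, j)\<close>\<close>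
    let ?U = "\<lambda>k l. if k = j then if l = i then 1 else 0 else 0 :: real"
    have pick: "endo_trace e (endo_of_entries e ?U o\<^sub>L X) = entry e X i j" for X
      by (simp add: endo_trace_compose[OF e] entry_endo_of_entries[OF e] 
          if_distrib[where f = "\<lambda>c. c * _"] cong: if_cong)
        (subst sum.remove[of _ j], auto)
    show "entry e (T v) i j = entry e (T' v) i j"
      using tr[of "endo_of_entries e ?U"] unfolding pick .
  qed
qed

lemma gen_newton_eq:
  assumes "orthonormal_basis e"
  shows "gen_newton e A = newton_formula e A"
  unfolding gen_newton_def
  by (rule the_equality)
     (rule is_gen_newton_newton_formula[OF assms], rule is_gen_newton_unique[OF assms _ is_gen_newton_newton_formula[OF assms]])

section \<open>The operators \<open>S\<^sub>r\<close>, \<open>T\<^sub>r\<close> and \<open>T\<^sup>\<alpha>\<close>\<close>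

lemma prod_pairs:
  fixes f :: "nat \<Rightarrow> real"
  shows "(\<Prod>k<m. f (2 * k) * f (2 * k + 1)) = (\<Prod>k<2 * m. f k)"
  by (induction m) (simp_all add: mult_ac)

lemma pair_sum_eq:
  fixes A :: "('v::real_inner \<Rightarrow>\<^sub>L 'v)^'q::finite"
  shows "pair_sum e A m is js =
    (\<Sum>as | length as = m. \<Prod>k<2 * m. entries e A (doubled as ! k) (is ! k) (js ! k))"
  unfolding pair_sum_def
proof (rule sum.cong)
  fix as :: "'q list" assume "as \<in> {as. length as = m}"
  then show "(\<Prod>k<m. entry e (A $ (as ! k)) (is ! (2 * k)) (js ! (2 * k)) *
        entry e (A $ (as ! k)) (is ! (2 * k + 1)) (js ! (2 * k + 1))) =
      (\<Prod>k<2 * m. entries e A (doubled as ! k) (is ! k) (js ! k))"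
    unfolding prod_pairs[symmetric] by (intro prod.cong) (auto simp: nth_doubled)
qed simp

lemma sum_pull_out:
  fixes g :: "'a \<Rightarrow> 'b \<Rightarrow> real"
  shows "(\<Sum>x\<in>X. \<Sum>y\<in>Y. g x y * (\<Sum>z\<in>Z. f z x y)) = (\<Sum>z\<in>Z. \<Sum>x\<in>X. \<Sum>y\<in>Y. g x y * f z x y)"
proof -
  have "(\<Sum>x\<in>X. \<Sum>y\<in>Y. g x y * (\<Sum>z\<in>Z. f z x y)) = (\<Sum>x\<in>X. \<Sum>z\<in>Z. \<Sum>y\<in>Y. g x y * f z x y)"
    unfolding sum_distrib_left by (intro sum.cong refl sum.swap)
  also have "\<dots> = (\<Sum>z\<in>Z. \<Sum>x\<in>X. \<Sum>y\<in>Y. g x y * f z x y)"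
    by (rule sum.swap)
  finally show ?thesis .
qed

lemma S_even_eq:
  "S_even e A (2 * m) = (\<Sum>as | length as = m. mixed_minors (map (entries e A) (doubled as))) / fact (2 * m)"
proof -
  have "(\<Sum>is | length is = 2 * m. \<Sum>js | length js = 2 * m. gen_kronecker is js * pair_sum e A m is js) =
      (\<Sum>as | length as = m. mixed_minors (map (entries e A) (doubled as)))"
    unfolding pair_sum_eq sum_pull_out by (rule sum.cong) (auto simp: mixed_minors_def)
  then show ?thesis
    by (simp add: S_even_def)
qed

lemma entry_T_even:
  assumes "orthonormal_basis e"
  shows "entry e (T_even e A (2 * m)) i j =
    (\<Sum>as | length as = m. mixed_cofactor (map (entries e A) (doubled as)) j i) / fact (2 * m)"
proof -
  have "(\<Sum>is | length is = 2 * m. \<Sum>js | length js = 2 * m.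
        gen_kronecker (is @ [j]) (js @ [i]) * pair_sum e A m is js) =
      (\<Sum>as | length as = m. mixed_cofactor (map (entries e A) (doubled as)) j i)"
    unfolding pair_sum_eq sum_pull_out by (rule sum.cong) (auto simp: mixed_cofactor_def)
  then show ?thesis
    by (simp add: T_even_def entry_endo_of_entries[OF assms])
qed

text \<open>
  The last position \<open>2 n\<close> carries the extra letter, so this is again a sum over words of cofactors.
\<close>
lemma entry_T_odd:
  assumes "orthonormal_basis e"
  shows "entry e (T_odd e A \<alpha> (Suc (2 * n))) i j =
    (\<Sum>as | length as = n. mixed_cofactor (map (entries e A) (doubled as @ [\<alpha>])) j i) / fact (Suc (2 * n))"
proof -
  have "(\<Sum>is | length is = Suc (2 * n). \<Sum>js | length js = Suc (2 * n).
        gen_kronecker (is @ [j]) (js @ [i]) * entry e (A $ \<alpha>) (is ! (2 * n)) (js ! (2 * n)) * pair_sum e A n is js) =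
      (\<Sum>as | length as = n. mixed_cofactor (map (entries e A) (doubled as @ [\<alpha>])) j i)"
    unfolding pair_sum_eq sum_pull_out
    by (rule sum.cong) (auto simp: mixed_cofactor_def nth_append mult_ac intro!: sum.cong)
  then show ?thesis
    by (simp add: T_odd_def entry_endo_of_entries[OF assms] del: fact_Suc)
qed

theorem theorem2p5:
  fixes e :: "'p::finite \<Rightarrow> 'v::real_inner"
    and A :: "('v \<Rightarrow>\<^sub>L 'v)^'q::finite"
    and r :: nat
  assumes "orthonormal_basis e"
    and "even r"
  shows "T_even e A r =
           (\<Sum>u | mi_even u \<and> mi_size u = r.
              (multinom (r div 2) (mi_half u) * inverse (multinom r u)) *\<^sub>R gen_newton e A u)
       \<and> S_even e A r =
           (\<Sum>u | mi_even u \<and> mi_size u = r.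
              multinom (r div 2) (mi_half u) * inverse (multinom r u) * sigma_coeff e A u)
       \<and> (r \<ge> 2 \<longrightarrow> (\<forall>\<alpha>. T_odd e A \<alpha> (r - 1) =
           (\<Sum>u | mi_even u \<and> mi_size u = r.
              (multinom (r div 2) (mi_half u) * inverse (multinom r u)) *\<^sub>R
                at_flat (gen_newton e A) \<alpha> u)))"
proof -
  note e = assms(1)
  obtain m where r: "r = 2 * m"
    using \<open>even r\<close> by (elim evenE)
  let ?U = "{u :: 'q \<Rightarrow> nat. mi_even u \<and> mi_size u = 2 * m}"
  let ?c = "\<lambda>u. multinom m (mi_half u) * inverse (multinom (2 * m) u)"
  let ?C = "\<lambda>i j w. mixed_cofactor (map (entries e A) w) j i"
  have cofactor_sym: "?C i j w = ?C i j w'" if "mset w = mset w'" for i j w w'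
    using that by (intro mixed_cofactor_symmetric) simp
  have T: "T_even e A (2 * m) = (\<Sum>u\<in>?U. ?c u *\<^sub>R gen_newton e A u)"
  proof (rule endo_eqI[OF e])
    fix i j
    have "(\<Sum>as | length as = m. ?C i j (doubled as)) = (\<Sum>u\<in>?U. ?c u * (\<Sum>w\<in>words_of u. ?C i j w))"
      by (rule sum_doubled) (rule cofactor_sym)
    then have "entry e (T_even e A (2 * m)) i j = (\<Sum>u\<in>?U. ?c u * (\<Sum>w\<in>words_of u. ?C i j w)) / fact (2 * m)"
      by (simp only: entry_T_even[OF e])
    also have "\<dots> = (\<Sum>u\<in>?U. ?c u * ((\<Sum>w\<in>words_of u. ?C i j w) / fact (mi_size u)))"
      by (simp add: sum_divide_distrib[of _ ?U])
    also have "\<dots> = entry e (\<Sum>u\<in>?U. ?c u *\<^sub>R gen_newton e A u) i j"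
      by (simp add: entry_sum entry_scaleR gen_newton_eq[OF e] newton_formula_def entry_endo_of_entries[OF e])
    finally show "entry e (T_even e A (2 * m)) i j = entry e (\<Sum>u\<in>?U. ?c u *\<^sub>R gen_newton e A u) i j" .
  qed
  have "(\<Sum>as | length as = m. mixed_minors (map (entries e A) (doubled as))) =
      (\<Sum>u\<in>?U. ?c u * (\<Sum>w\<in>words_of u. mixed_minors (map (entries e A) w)))"
    by (rule sum_doubled) (simp add: mixed_minors_symmetric)
  then have "S_even e A (2 * m) = (\<Sum>u\<in>?U. ?c u * (\<Sum>w\<in>words_of u. mixed_minors (map (entries e A) w))) / fact (2 * m)"
    by (simp only: S_even_eq)
  also have "\<dots> = (\<Sum>u\<in>?U. ?c u * sigma_coeff e A u)"
    by (simp add: sum_divide_distrib[of _ ?U] sigma_coeff_eq[OF e] sigma_formula_def)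
  finally have S: "S_even e A (2 * m) = (\<Sum>u\<in>?U. ?c u * sigma_coeff e A u)" .
  have O: "T_odd e A \<alpha> (2 * m - 1) = (\<Sum>u\<in>?U. ?c u *\<^sub>R at_flat (gen_newton e A) \<alpha> u)" if "2 * m \<ge> 2" for \<alpha>
  proof (rule endo_eqI[OF e])
    fix i j
    obtain n where m: "m = Suc n"
      using \<open>2 * m \<ge> 2\<close> by (cases m) auto
    have "(\<Sum>as | length as = n. ?C i j (doubled as @ [\<alpha>])) =
        (\<Sum>u\<in>?U. ?c u * at_flat (\<lambda>u. \<Sum>w\<in>words_of u. ?C i j w) \<alpha> u)"
      unfolding m by (rule sum_doubled_snoc) (rule cofactor_sym)
    moreover have "2 * m - 1 = Suc (2 * n)"
      using m by simp
    ultimately have "entry e (T_odd e A \<alpha> (2 * m - 1)) i j =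
        (\<Sum>u\<in>?U. ?c u * at_flat (\<lambda>u. \<Sum>w\<in>words_of u. ?C i j w) \<alpha> u) / fact (2 * m - 1)"
      by (simp only: entry_T_odd[OF e])
    also have "\<dots> = (\<Sum>u\<in>?U. ?c u * at_flat (\<lambda>u. (\<Sum>w\<in>words_of u. ?C i j w) / fact (mi_size u)) \<alpha> u)"
      unfolding sum_divide_distrib[of _ ?U]
    proof (rule sum.cong)
      fix u assume u: "u \<in> ?U"
      have "mi_size (u(\<alpha> := u \<alpha> - 1)) = 2 * m - 1" if "u \<alpha> \<noteq> 0"
        using u mi_size_Suc[of "u(\<alpha> := u \<alpha> - 1)" \<alpha>] that by simp
      then show "?c u * at_flat (\<lambda>u. \<Sum>w\<in>words_of u. ?C i j w) \<alpha> u / fact (2 * m - 1) =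
          ?c u * at_flat (\<lambda>u. (\<Sum>w\<in>words_of u. ?C i j w) / fact (mi_size u)) \<alpha> u"
        by (simp add: at_flat_def)
    qed simp
    also have "\<dots> = entry e (\<Sum>u\<in>?U. ?c u *\<^sub>R at_flat (gen_newton e A) \<alpha> u) i j"
      unfolding entry_sum entry_scaleR
    proof (rule sum.cong)
      fix u
      show "?c u * at_flat (\<lambda>u. (\<Sum>w\<in>words_of u. ?C i j w) / fact (mi_size u)) \<alpha> u =
          ?c u * entry e (at_flat (gen_newton e A) \<alpha> u) i j"
        by (simp add: at_flat_def gen_newton_eq[OF e] newton_formula_def entry_endo_of_entries[OF e])
           (simp add: entry_def)
    qed simp
    finally show "entry e (T_odd e A \<alpha> (2 * m - 1)) i j =
        entry e (\<Sum>u\<in>?U. ?c u *\<^sub>R at_flat (gen_newton e A) \<alpha> u) i j" .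
  qed
  show ?thesis
    using T S O by (simp add: r)
qed

end
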